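(* For every text $T$ of length $n$ and every parameter $\tau=o(\frac{\log n}{\log\log n})$ there exists a data structure of size $\mathcal{O}(\frac{n\log \tau}{\log n})$ which can answer in $\mathcal{O}(1)$ time Minimal Suffix Queries for fragments $v$ of length not exceeding $\tau$ (i.e., report the length of the lexicographically smallest non-empty suffix of a given fragment $v=T[\ell..r]$ with $|v|\le\tau$). Moreover, it can be constructed in $\mathcal{O}(n)$ time.
   Context: Model: the word RAM with machine words of $W=\Omega(\log n)$ bits; sizes are measured in machine words. The text $T$ of length $n$ is over $\Sigma=\{0,\ldots,\sigma-1\}$ with $\sigma=n^{\mathcal{O}(1)}$, ordered naturally; strings are compared lexicographically (a proper prefix is smaller). A fragment $T[\ell..r]$ is the occurrence of $T[\ell]\cdots T[r]$ at position $\ell$, given by $(\ell,r)$. *)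

theory Defs
  imports
    Complex_Main
    "HOL-Library.Landau_Symbols"
    "HOL-Library.List_Lexorder"
    "HOL-Library.More_List"
    "HOL-Library.Sublist"
begin

section \<open>Word RAM\<close>

text \<open>
  Registers and memory cells hold natural numbers below \<open>2 ^ b\<close>, where \<open>b\<close> is a
  parameter of the semantics; memory is addressed by such numbers. Results are reduced modulo
  \<open>2 ^ b\<close>, subtraction wraps around, and dividing by \<open>0\<close> follows \<^term>\<open>x div (0::nat) = 0\<close>
  and \<^term>\<open>x mod (0::nat) = x\<close>.
  Control flow is structured (tests and loops instead of jumps), which affects running
  times only by a constant factor. Every elementary instruction and every test costs one step.
  A program is a finite syntactic object, so it mentions only finitely many registers and constants.
\<close>

type_synonym reg = nat

datatype binop = Add | Sub | Mul | Div | Mod | And | Or | Xor | Shl | Shr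

datatype cmp = Eq | Neq | Lt | Le

datatype instr =
    Const reg nat
  | Op binop reg reg reg
  | Load reg reg
  | Store reg reg

datatype prog =
    Skip
  | Instr instr
  | Seq prog prog
  | If cmp reg reg prog prog
  | While cmp reg reg prog

type_synonym state = "(reg \<Rightarrow> nat) \<times> (nat \<Rightarrow> nat)"

fun binop_val :: "nat \<Rightarrow> binop \<Rightarrow> nat \<Rightarrow> nat \<Rightarrow> nat" where
  "binop_val b Add x y = take_bit b (x + y)"
| "binop_val b Sub x y = nat (take_bit b (int x - int y))"
| "binop_val b Mul x y = take_bit b (x * y)"
| "binop_val b Div x y = take_bit b (x div y)"
| "binop_val b Mod x y = take_bit b (x mod y)"
| "binop_val b And x y = take_bit b (Bit_Operations.and x y)"
| "binop_val b Or x y = take_bit b (Bit_Operations.or x y)"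
| "binop_val b Xor x y = take_bit b (Bit_Operations.xor x y)"
| "binop_val b Shl x y = take_bit b (push_bit y x)"
| "binop_val b Shr x y = take_bit b (drop_bit y x)"

fun cmp_holds :: "cmp \<Rightarrow> nat \<Rightarrow> nat \<Rightarrow> bool" where
  "cmp_holds Eq x y \<longleftrightarrow> x = y"
| "cmp_holds Neq x y \<longleftrightarrow> x \<noteq> y"
| "cmp_holds Lt x y \<longleftrightarrow> x < y"
| "cmp_holds Le x y \<longleftrightarrow> x \<le> y"

text \<open>The destination register comes first; \<open>Store i j\<close> writes register \<open>j\<close> to the cell
  whose address is in register \<open>i\<close>.\<close>

fun step :: "nat \<Rightarrow> instr \<Rightarrow> state \<Rightarrow> state" where
  "step b (Const i k) (R, M) = (R(i := take_bit b k), M)"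
| "step b (Op f i j k) (R, M) = (R(i := binop_val b f (R j) (R k)), M)"
| "step b (Load i j) (R, M) = (R(i := M (R j)), M)"
| "step b (Store i j) (R, M) = (R, M(R i := R j))"

text \<open>\<open>exec b p s t s'\<close>: with \<open>b\<close>-bit words, \<open>p\<close> started in state \<open>s\<close> halts after \<open>t\<close> steps in
  state \<open>s'\<close>.\<close>

inductive exec :: "nat \<Rightarrow> prog \<Rightarrow> state \<Rightarrow> nat \<Rightarrow> state \<Rightarrow> bool" for b :: nat where
  Skip: "exec b Skip s 0 s"
| Instr: "exec b (Instr a) s 1 (step b a s)"
| Seq: "exec b p s t s' \<Longrightarrow> exec b q s' u s'' \<Longrightarrow> exec b (Seq p q) s (t + u) s''"
| IfTrue: "cmp_holds c (fst s i) (fst s j) \<Longrightarrow> exec b p s t s' \<Longrightarrow> exec b (If c i j p q) s (t + 1) s'"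
| IfFalse: "\<not> cmp_holds c (fst s i) (fst s j) \<Longrightarrow> exec b q s t s' \<Longrightarrow> exec b (If c i j p q) s (t + 1) s'"
| WhileFalse: "\<not> cmp_holds c (fst s i) (fst s j) \<Longrightarrow> exec b (While c i j p) s 1 s"
| WhileTrue: "cmp_holds c (fst s i) (fst s j) \<Longrightarrow> exec b p s t s' \<Longrightarrow>
    exec b (While c i j p) s' u s'' \<Longrightarrow> exec b (While c i j p) s (t + u + 1) s''"

definition fits :: "nat \<Rightarrow> state \<Rightarrow> bool" where
  "fits b s \<longleftrightarrow> (\<forall>i. fst s i < 2 ^ b) \<and> (\<forall>a. snd s a < 2 ^ b)"

text \<open>\<open>init xs ys\<close>: arguments \<open>xs\<close> in the registers \<open>0, 1, \<dots>\<close>, memory contents \<open>ys\<close> from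
  address \<open>0\<close> on, and zeros everywhere else.\<close>

definition init :: "nat list \<Rightarrow> nat list \<Rightarrow> state" where
  "init xs ys = (nth_default 0 xs, nth_default 0 ys)"

lemma exec_deterministic:
  "exec b p s t s' \<Longrightarrow> exec b p s u s'' \<Longrightarrow> t = u \<and> s' = s''"
proof (induction arbitrary: u s'' rule: exec.induct)
  case Skip
  then show ?case by (auto elim: exec.cases)
next
  case Instr
  then show ?case by (auto elim: exec.cases)
next
  case (Seq p s t s' q u' s2)
  from Seq.prems show ?case by cases (use Seq.IH in blast)
next
  case (IfTrue c s i j p t s' q)
  from IfTrue.prems show ?case by cases (use IfTrue in blast)+
next
  case (IfFalse c s i j q t s' p)
  from IfFalse.prems show ?case by cases (use IfFalse in blast)+
next
  case (WhileFalse c s i j p)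
  from WhileFalse.prems show ?case by cases (use WhileFalse in auto)
next
  case (WhileTrue c s i j p t s' u' s2)
  from WhileTrue.prems show ?case by cases (use WhileTrue in blast)+
qed

lemma fits_step: "fits b s \<Longrightarrow> fits b (step b a s)"
proof -
  have tb: "take_bit b z < 2 ^ b" for z :: nat by simp
  have op: "binop_val b f x y < 2 ^ b" for f x y
  proof (cases f)
    case Sub
    have "take_bit b (int x - int y) < 2 ^ b" by simp
    then show ?thesis using Sub by (simp add: nat_less_iff)
  qed (simp_all only: binop_val.simps tb)
  show "fits b s \<Longrightarrow> fits b (step b a s)"
    by (cases a; cases s) (simp_all add: fits_def op)
qed

lemma fits_exec: "exec b p s t s' \<Longrightarrow> fits b s \<Longrightarrow> fits b s'"
  by (induction rule: exec.induct) (simp_all add: fits_step)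


section \<open>Minimal suffix queries\<close>

text \<open>Positions are counted from \<open>0\<close>; \<open>fragment T l r\<close> is meant for \<open>l \<le> r < length T\<close>.\<close>

definition fragment :: "'a list \<Rightarrow> nat \<Rightarrow> nat \<Rightarrow> 'a list" where
  "fragment T l r = take (r + 1 - l) (drop l T)"

text \<open>Lists are ordered by the instance of \<^class>\<open>linorder\<close> from
  \<^theory>\<open>HOL-Library.List_Lexorder\<close>, in which a proper prefix is smaller.\<close>

definition min_suffix :: "'a::linorder list \<Rightarrow> 'a list" where
  "min_suffix v = Min {u. suffix u v \<and> u \<noteq> []}"

text \<open>A data structure is a list \<open>D\<close> of memory cells. The construction gets the text in memory
  and \<open>n\<close>, \<open>\<sigma>\<close>, \<open>\<tau>\<close> in registers, and returns the start address and the number of cells of \<open>D\<close>.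
  A query runs on a memory that contains nothing but \<open>D\<close>; in particular it cannot access
  the text.\<close>

definition constructs :: "nat \<Rightarrow> prog \<Rightarrow> nat list \<Rightarrow> nat \<Rightarrow> nat \<Rightarrow> real \<Rightarrow> nat list \<Rightarrow> bool" where
  "constructs b build T \<sigma> \<tau> time D \<longleftrightarrow>
     fits b (init [length T, \<sigma>, \<tau>] T) \<and>
     (\<exists>t R M. exec b build (init [length T, \<sigma>, \<tau>] T) t (R, M) \<and> real t \<le> time \<and>
        D = map M [R 0..<R 0 + R 1])"

definition answers_min_suffix_queries ::
    "nat \<Rightarrow> prog \<Rightarrow> nat list \<Rightarrow> nat list \<Rightarrow> nat \<Rightarrow> real \<Rightarrow> bool" where
  "answers_min_suffix_queries b query D T \<tau> time \<longleftrightarrow>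
     (\<forall>l r. l \<le> r \<and> r < length T \<and> length (fragment T l r) \<le> \<tau> \<longrightarrow>
        fits b (init [l, r] D) \<and>
        (\<exists>t R M. exec b query (init [l, r] D) t (R, M) \<and> real t \<le> time \<and>
           R 0 = length (min_suffix (fragment T l r))))"

end

(*
  A fragment of length at most \<tau> that starts in the block of \<tau> positions with index i lies in the
  window of 2\<tau> positions formed by the blocks i and i + 1. The length of its minimal suffix depends only
  on the relative order of the letters, so each letter may be replaced by its rank in the window,
  a number from 1 to 2\<tau>. A rank takes b = O(log \<tau>) bits, a window O(\<tau> log \<tau>) = o(log n) bits,
  and packing P windows into each cell, with P as large as 2^(2\<tau>bP) <= n permits, needs
  O(n log \<tau> / log n) cells. The ranks of all windows are obtained in O(n) time from one radix
  sort of the positions by letter: while the positions are scanned in this order, each window counts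
  the distinct letters that it has met. A query cuts the ranks of the fragment out of a cell
  by a shift and a mask and uses the resulting number, which is less than 2^(\<tau>b) = n^o(1), as an index
  into a precomputed table. The table is filled by brute force: suffixes that are padded
  with zeros to \<tau> digits are compared as numbers. For \<tau> = 1 the bound log \<tau> = 0 forces
  an empty structure, which suffices since all fragments then have length 1.
*)
theory Submission
  imports Defs "HOL-Library.Multiset" "HOL-Real_Asymp.Real_Asymp"
begin

section \<open>Running time triples for the word RAM\<close>

text \<open>The table index contains no separate length. Ranks start at 1, so the leading digit of a
  rank string is nonzero and the number of base \<open>2 ^ b\<close> digits of the index is the
  length of the fragment; one table serves all lengths up to \<tau>. The digit \<open>0\<close>
  stays free for padding. Inside a window ranks are stored from right to left, so that the first
  letter of a fragment becomes its most significant digit: suffixes are then remainders modulo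
  powers of \<open>2 ^ b\<close>. A fragment has at most half as many digits as a window, and a
  window satisfies \<open>2 ^ (2 * \<tau> * b) \<le> n\<close>; hence the table has at most
  \<open>sqrt n\<close> entries, which pays for \<tau> comparisons per entry in O(n) time and for
  the space beside the cells. The machine computes modulo the word size and the structure shares the
  memory with the scratch space of the sort, so most side conditions say that a result does not
  overflow or that two regions are disjoint; both are met by placing the structure at
  \<open>n ^ 3\<close> and by a word length of at least \<open>(k + 6) * log 2 n\<close>
  bits.\<close>

definition wp :: "nat \<Rightarrow> prog \<Rightarrow> nat \<Rightarrow> (state \<Rightarrow> bool) \<Rightarrow> state \<Rightarrow> bool" where
  "wp b p t Q s \<longleftrightarrow> (\<exists>t' s'. exec b p s t' s' \<and> t' \<le> t \<and> Q s')"

text \<open>The trailing \<open>Skip\<close> gives every instruction a continuation, so one rewrite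
  rule per kind of instruction, stated for an instruction followed by a program, suffices for
  symbolic execution by \<open>simp\<close>.\<close>

fun seqs :: "prog list \<Rightarrow> prog" where
  "seqs [] = Skip"
| "seqs (p # ps) = Seq p (seqs ps)"

lemma wp_mono: "wp b p t Q s \<Longrightarrow> t \<le> t' \<Longrightarrow> (\<And>s'. Q s' \<Longrightarrow> Q' s') \<Longrightarrow> wp b p t' Q' s"
  unfolding wp_def by (meson le_trans)

lemma wp_Seq: "wp b p t (\<lambda>s'. wp b q u Q s') s \<Longrightarrow> t + u \<le> v \<Longrightarrow> wp b (Seq p q) v Q s"
  unfolding wp_def by (meson exec.Seq add_mono le_trans)

lemma wp_SeqI:
  assumes "wp b p t I s" "\<And>s'. I s' \<Longrightarrow> wp b q u Q s'" "t + u \<le> v"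
  shows "wp b (Seq p q) v Q s"
  by (rule wp_Seq[OF wp_mono[OF assms(1) order_refl assms(2)] assms(3)])

lemmas wp_SeqI' = wp_SeqI[OF _ _ order_refl]

lemma wp_Skip: "wp b Skip t Q s \<longleftrightarrow> Q s"
proof
  assume "Q s"
  with exec.Skip[of b s] show "wp b Skip t Q s"
    unfolding wp_def by (intro exI[of _ 0] exI[of _ s]) auto
qed (auto simp: wp_def elim: exec.cases)

lemma wp_Instr: "1 \<le> t \<Longrightarrow> wp b (Seq (Instr a) p) t Q s \<longleftrightarrow> wp b p (t - 1) Q (step b a s)"
proof
  assume t: "1 \<le> t" and "wp b (Seq (Instr a) p) t Q s"
  then obtain u s' where e: "exec b (Seq (Instr a) p) s u s'" "u \<le> t" "Q s'"
    unfolding wp_def by blast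
  from e(1) obtain u1 u2 s1 where "exec b (Instr a) s u1 s1" "exec b p s1 u2 s'" "u = u1 + u2"
    by (auto elim: exec.cases)
  moreover from this(1) have "u1 = 1" "s1 = step b a s" by (auto elim: exec.cases)
  ultimately show "wp b p (t - 1) Q (step b a s)"
    using e t unfolding wp_def by (intro exI[of _ u2] exI[of _ s']) auto
next
  assume t: "1 \<le> t" and "wp b p (t - 1) Q (step b a s)"
  then obtain u s' where "exec b p (step b a s) u s'" "u \<le> t - 1" "Q s'"
    unfolding wp_def by blast
  with t show "wp b (Seq (Instr a) p) t Q s"
    unfolding wp_def using exec.Seq[OF exec.Instr] by (intro exI[of _ "1 + u"] exI[of _ s']) auto
qed

text \<open>Once a conditional is resolved, the chosen branch stands as a nested sequence before the
  rest; reassociation exposes its first instruction to the rewrite rules.\<close>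

lemma wp_Seq_assoc: "wp b (Seq (Seq p q) r) t Q s \<longleftrightarrow> wp b (Seq p (Seq q r)) t Q s"
proof -
  have "exec b (Seq (Seq p q) r) s t' s' \<longleftrightarrow> exec b (Seq p (Seq q r)) s t' s'" for t' s'
  proof
    assume "exec b (Seq (Seq p q) r) s t' s'"
    then show "exec b (Seq p (Seq q r)) s t' s'"
    proof cases
      case (Seq u s1 v)
      from this(2) show ?thesis
      proof cases
        case (Seq u' s2 v')
        then show ?thesis using exec.Seq[OF Seq(2) exec.Seq[OF Seq(3)]] \<open>exec b r s1 v s'\<close> \<open>t' = u + v\<close>
          by (simp add: add.assoc)
      qed
    qed
  next
    assume "exec b (Seq p (Seq q r)) s t' s'"
    then show "exec b (Seq (Seq p q) r) s t' s'"
    proof cases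
      case (Seq u s1 v)
      from this(3) show ?thesis
      proof cases
        case (Seq u' s2 v')
        then show ?thesis using exec.Seq[OF exec.Seq[OF \<open>exec b p s u s1\<close> Seq(2)] Seq(3)] \<open>t' = u + v\<close>
          by (simp add: add.assoc)
      qed
    qed
  qed
  then show ?thesis unfolding wp_def by simp
qed

lemma wp_Seq_Skip: "wp b (Seq Skip p) t Q s \<longleftrightarrow> wp b p t Q s"
proof -
  have "exec b (Seq Skip p) s t' s' \<longleftrightarrow> exec b p s t' s'" for t' s'
    using exec.Seq[OF exec.Skip, of b p s t' s'] by (auto elim!: exec.cases[of b "Seq Skip p"] exec.cases[of b Skip])
  then show ?thesis unfolding wp_def by simp
qed

lemma wp_If:
  assumes "1 \<le> t"
  shows "wp b (Seq (If c i j p q) r) t Q (R, M) \<longleftrightarrow>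
    (if cmp_holds c (R i) (R j) then wp b (Seq p r) (t - 1) Q (R, M)
     else wp b (Seq q r) (t - 1) Q (R, M))"
proof -
  define p' where "p' = (if cmp_holds c (R i) (R j) then p else q)"
  have "wp b (Seq (If c i j p q) r) t Q (R, M) \<longleftrightarrow> wp b (Seq p' r) (t - 1) Q (R, M)"
  proof
    assume "wp b (Seq (If c i j p q) r) t Q (R, M)"
    then obtain u v s1 s' where e: "exec b (If c i j p q) (R, M) u s1" "exec b r s1 v s'"
      "u + v \<le> t" "Q s'"
      unfolding wp_def by (auto elim: exec.cases)
    from e(1) obtain u' where "exec b p' (R, M) u' s1" "u = u' + 1"
      by cases (auto simp: p'_def)
    then show "wp b (Seq p' r) (t - 1) Q (R, M)"
      unfolding wp_def using exec.Seq[OF _ e(2), of p' "(R, M)" u'] e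
      by (intro exI[of _ "u' + v"] exI[of _ s']) auto
  next
    assume "wp b (Seq p' r) (t - 1) Q (R, M)"
    then obtain u v s1 s' where e: "exec b p' (R, M) u s1" "exec b r s1 v s'"
      "u + v \<le> t - 1" "Q s'"
      unfolding wp_def by (auto elim: exec.cases)
    have "exec b (If c i j p q) (R, M) (u + 1) s1"
      using e(1) exec.IfTrue[of c "(R, M)" i j b p u s1 q] exec.IfFalse[of c "(R, M)" i j b q u s1 p]
      by (simp add: p'_def split: if_splits)
    from exec.Seq[OF this e(2)] show "wp b (Seq (If c i j p q) r) t Q (R, M)"
      unfolding wp_def using e assms by (intro exI[of _ "u + 1 + v"] exI[of _ s']) auto
  qed
  then show ?thesis by (simp add: p'_def)
qed

text \<open>Indexing the invariant by the iteration settles termination and time together: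
  \<open>N\<close> is the exact number of iterations. The budget \<open>f i\<close> may vary with
  \<open>i\<close>, which permits the amortised bound for collecting buckets of unequal size. Each
  \<open>+ 1\<close> pays for a test, the last one for the test that fails.\<close>

lemma wp_While:
  assumes init: "I 0 s"
    and cont: "\<And>i s. i < N \<Longrightarrow> I i s \<Longrightarrow> cmp_holds c (fst s x) (fst s y)"
    and body: "\<And>i s. i < N \<Longrightarrow> I i s \<Longrightarrow> wp b p (f i) (I (Suc i)) s"
    and stop: "\<And>s. I N s \<Longrightarrow> \<not> cmp_holds c (fst s x) (fst s y)"
    and time: "(\<Sum>i<N. f i + 1) + 1 \<le> t"
    and post: "\<And>s. I N s \<Longrightarrow> Q s"
  shows "wp b (While c x y p) t Q s"
proof -
  have "j \<le> N \<Longrightarrow> I (N - j) s \<Longrightarrow>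
      wp b (While c x y p) ((\<Sum>i=N-j..<N. f i + 1) + 1) (I N) s" for j s
  proof (induction j arbitrary: s)
    case 0
    then have "exec b (While c x y p) s 1 s" by (intro exec.WhileFalse stop) auto
    then show ?case using 0 unfolding wp_def by (intro exI[of _ 1] exI[of _ s]) auto
  next
    case (Suc j)
    then have lt: "N - Suc j < N" and sj: "Suc (N - Suc j) = N - j" by auto
    obtain u s1 where 1: "exec b p s u s1" "u \<le> f (N - Suc j)" "I (N - j) s1"
      using body[OF lt Suc.prems(2)] unfolding wp_def sj by blast
    obtain v s' where 2: "exec b (While c x y p) s1 v s'" "v \<le> (\<Sum>i=N-j..<N. f i + 1) + 1" "I N s'"
      using Suc.IH[OF _ 1(3)] Suc.prems unfolding wp_def by auto
    have "(\<Sum>i=N-Suc j..<N. f i + 1) = f (N - Suc j) + 1 + (\<Sum>i=N-j..<N. f i + 1)"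
      using sum.atLeast_Suc_lessThan[OF lt, of "\<lambda>i. f i + 1"] sj by simp
    then show ?case
      using exec.WhileTrue[OF cont[OF lt Suc.prems(2)] 1(1) 2(1)] 1(2) 2(2,3)
      unfolding wp_def by (intro exI[of _ "u + v + 1"] exI[of _ s']) auto
  qed
  from this[of N s] init have "wp b (While c x y p) ((\<Sum>i<N. f i + 1) + 1) (I N) s"
    by (simp add: atLeast0LessThan)
  then show ?thesis by (rule wp_mono) (use time post in auto)
qed

text \<open>The rules from here on replace modular arithmetic by exact arithmetic, at the price of a
  side condition that the result fits into a word.\<close>

lemma wp_Const: "k < 2 ^ b \<Longrightarrow> 1 \<le> t \<Longrightarrow>
    wp b (Seq (Instr (Const i k)) p) t Q (R, M) \<longleftrightarrow> wp b p (t - 1) Q (R(i := k), M)"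
  by (simp add: wp_Instr take_bit_nat_eq_self)

lemma wp_Add: "R j + R k < 2 ^ b \<Longrightarrow> 1 \<le> t \<Longrightarrow>
    wp b (Seq (Instr (Op Add i j k)) p) t Q (R, M) \<longleftrightarrow> wp b p (t - 1) Q (R(i := R j + R k), M)"
  by (simp add: wp_Instr take_bit_nat_eq_self)

text \<open>The machine subtracts in the integers and wraps around; for \<open>R k \<le> R j\<close>
  this is the subtraction of natural numbers.\<close>

lemma wp_Sub: "R k \<le> R j \<Longrightarrow> R j < 2 ^ b \<Longrightarrow> 1 \<le> t \<Longrightarrow>
    wp b (Seq (Instr (Op Sub i j k)) p) t Q (R, M) \<longleftrightarrow> wp b p (t - 1) Q (R(i := R j - R k), M)"
proof -
  assume a: "R k \<le> R j" "R j < 2 ^ b" "1 \<le> t"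
  then have "take_bit b (int (R j) - int (R k)) = int (R j - R k)"
    by (simp add: of_nat_diff[symmetric] take_bit_of_nat take_bit_nat_eq_self del: of_nat_diff)
  then show ?thesis using a by (simp add: wp_Instr del: of_nat_diff)
qed

lemma wp_Mul: "R j * R k < 2 ^ b \<Longrightarrow> 1 \<le> t \<Longrightarrow>
    wp b (Seq (Instr (Op Mul i j k)) p) t Q (R, M) \<longleftrightarrow> wp b p (t - 1) Q (R(i := R j * R k), M)"
  by (simp add: wp_Instr take_bit_nat_eq_self)

lemma wp_Div: "R j div R k < 2 ^ b \<Longrightarrow> 1 \<le> t \<Longrightarrow>
    wp b (Seq (Instr (Op Div i j k)) p) t Q (R, M) \<longleftrightarrow> wp b p (t - 1) Q (R(i := R j div R k), M)"
  by (simp add: wp_Instr take_bit_nat_eq_self)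

lemma wp_Mod: "R j mod R k < 2 ^ b \<Longrightarrow> 1 \<le> t \<Longrightarrow>
    wp b (Seq (Instr (Op Mod i j k)) p) t Q (R, M) \<longleftrightarrow> wp b p (t - 1) Q (R(i := R j mod R k), M)"
  by (simp add: wp_Instr take_bit_nat_eq_self)

lemma wp_Shl: "R j * 2 ^ R k < 2 ^ b \<Longrightarrow> 1 \<le> t \<Longrightarrow>
    wp b (Seq (Instr (Op Shl i j k)) p) t Q (R, M) \<longleftrightarrow> wp b p (t - 1) Q (R(i := R j * 2 ^ R k), M)"
  by (simp add: wp_Instr take_bit_nat_eq_self push_bit_eq_mult)

lemma wp_Shr: "R j div 2 ^ R k < 2 ^ b \<Longrightarrow> 1 \<le> t \<Longrightarrow>
    wp b (Seq (Instr (Op Shr i j k)) p) t Q (R, M) \<longleftrightarrow> wp b p (t - 1) Q (R(i := R j div 2 ^ R k), M)"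
  by (simp add: wp_Instr take_bit_nat_eq_self drop_bit_eq_div)

lemma wp_Load: "1 \<le> t \<Longrightarrow>
    wp b (Seq (Instr (Load i j)) p) t Q (R, M) \<longleftrightarrow> wp b p (t - 1) Q (R(i := M (R j)), M)"
  by (simp add: wp_Instr)

lemma wp_Store: "1 \<le> t \<Longrightarrow>
    wp b (Seq (Instr (Store i j)) p) t Q (R, M) \<longleftrightarrow> wp b p (t - 1) Q (R, M(R i := R j))"
  by (simp add: wp_Instr)

lemmas wp_simps = wp_Skip wp_Seq_assoc wp_Seq_Skip wp_Const wp_Add wp_Sub wp_Mul wp_Div wp_Mod
  wp_Shl wp_Shr wp_Load wp_Store wp_If

section \<open>Radix sort, digit strings and minimal suffixes\<close>

definition bucket_sort :: "('a \<Rightarrow> nat) \<Rightarrow> nat \<Rightarrow> 'a list \<Rightarrow> 'a list" where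
  "bucket_sort f m xs = concat (map (\<lambda>g. filter (\<lambda>x. f x = g) xs) [0..<m])"

lemma mset_bucket_sort:
  assumes "\<forall>x\<in>set xs. f x < m"
  shows "mset (bucket_sort f m xs) = mset xs"
proof -
  have "mset (concat (map (\<lambda>g. filter (\<lambda>x. f x = g) xs) [0..<m])) = filter_mset (\<lambda>x. f x < m) (mset xs)"
  proof (induction m)
    case (Suc m)
    have "filter_mset (\<lambda>x. f x < Suc m) (mset xs)
        = filter_mset (\<lambda>x. f x < m) (mset xs) + filter_mset (\<lambda>x. f x = m) (mset xs)"
      by (induction xs) auto
    then show ?case using Suc by simp
  qed simp
  moreover have "filter_mset (\<lambda>x. f x < m) (mset xs) = mset xs"
    using assms by (simp add: filter_mset_eq_conv)
  ultimately show ?thesis unfolding bucket_sort_def by simp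
qed

text \<open>Stability does the work: \<open>filter\<close> keeps the order inside a bucket, which is
  sorted by the lower digits already, and between buckets the digit at \<open>n ^ j\<close>
  outweighs all lower digits, whose value is below \<open>n ^ j\<close>.\<close>

lemma sorted_bucket_sort:
  assumes "0 < n" "sorted (map (\<lambda>x. key x mod n ^ j) xs)"
  shows "sorted (map (\<lambda>x. key x mod n ^ Suc j) (bucket_sort (\<lambda>x. key x div n ^ j mod n) m xs))"
proof -
  let ?bk = "\<lambda>g. filter (\<lambda>x. key x div n ^ j mod n = g) xs"
  have eq: "key x mod n ^ Suc j = n ^ j * (key x div n ^ j mod n) + key x mod n ^ j" for x
    using mod_mult2_eq[of "key x" "n ^ j" n] by (simp add: mult.commute)
  have "sorted (map (\<lambda>x. key x mod n ^ Suc j) (concat (map ?bk [0..<m])))"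
  proof (induction m)
    case (Suc m)
    have "sorted (map (\<lambda>x. key x mod n ^ j) (?bk m))"
      using assms(2) by (rule sorted_filter)
    moreover have "map (\<lambda>x. key x mod n ^ Suc j) (?bk m)
        = map (\<lambda>y. n ^ j * m + y) (map (\<lambda>x. key x mod n ^ j) (?bk m))"
      using eq by (auto simp: comp_def)
    ultimately have 1: "sorted (map (\<lambda>x. key x mod n ^ Suc j) (?bk m))"
      by (simp add: sorted_map[of "\<lambda>y. n ^ j * m + y"] del: map_map filter_map) 
    have 2: "key x mod n ^ Suc j \<le> key y mod n ^ Suc j"
      if "key x div n ^ j mod n < m" "key y div n ^ j mod n = m" for x y
    proof -
      have "key x mod n ^ j < n ^ j" using assms(1) by simp
      moreover have "n ^ j * (key x div n ^ j mod n) + n ^ j \<le> n ^ j * m"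
        using that(1) mult_le_mono2[of "Suc (key x div n ^ j mod n)" m "n ^ j"] by simp
      ultimately show ?thesis unfolding eq that(2) by linarith
    qed
    show ?case using Suc 1 2 by (auto simp: sorted_append)
  qed simp
  then show ?thesis unfolding bucket_sort_def .
qed


primrec radix_sort :: "('a \<Rightarrow> nat) \<Rightarrow> nat \<Rightarrow> nat \<Rightarrow> 'a list \<Rightarrow> 'a list" where
  "radix_sort key n 0 xs = xs"
| "radix_sort key n (Suc j) xs
    = bucket_sort (\<lambda>x. key x div n ^ j mod n) n (radix_sort key n j xs)"

lemma mset_radix_sort: "0 < n \<Longrightarrow> mset (radix_sort key n j xs) = mset xs"
  by (induction j) (simp_all add: mset_bucket_sort)

lemma sorted_radix_sort:
  assumes "0 < n" "\<forall>x\<in>set xs. key x < n ^ j"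
  shows "sorted (map key (radix_sort key n j xs))"
proof -
  \<comment> \<open>After \<open>i\<close> passes the list is sorted by the \<open>i\<close> lowest
    digits; the induction starts with remainders modulo \<open>1\<close>, which are all
    equal.\<close>
  have "sorted (map (\<lambda>x. key x mod n ^ i) (radix_sort key n i xs))" for i
  proof (induction i)
    case (Suc i)
    then show ?case using sorted_bucket_sort[OF assms(1), of key i] by simp
  qed (simp add: map_replicate_const)
  moreover have "map (\<lambda>x. key x mod n ^ j) (radix_sort key n j xs) = map key (radix_sort key n j xs)"
    using assms(2) mset_eq_setD[OF mset_radix_sort[OF assms(1), of key j xs]] by auto
  ultimately show ?thesis by metis
qed

section \<open>Digit strings as numbers, most significant digit first\<close>

definition digits_val :: "nat \<Rightarrow> nat list \<Rightarrow> nat" where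
  "digits_val B u = foldl (\<lambda>x a. x * B + a) 0 u"

lemma digits_val_snoc: "digits_val B (u @ [a]) = digits_val B u * B + a"
  and digits_val_Nil: "digits_val B [] = 0"
  by (simp_all add: digits_val_def)

lemma digits_val_append: "digits_val B (u @ v) = digits_val B u * B ^ length v + digits_val B v"
  by (induction v rule: rev_induct) (simp_all add: digits_val_Nil digits_val_snoc algebra_simps flip: append_assoc)

lemma digits_val_less: "\<forall>a\<in>set u. a < B \<Longrightarrow> digits_val B u < B ^ length u"
proof (induction u rule: rev_induct)
  case (snoc a u)
  then have "Suc (digits_val B u) * B \<le> B ^ length u * B" by (intro mult_right_mono) auto
  with snoc.prems show ?case by (simp add: digits_val_snoc algebra_simps)
qed (simp add: digits_val_Nil)

text \<open>Together with \<open>digits_val_less\<close> this makes the length of a string readable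
  from its value, provided that the leading digit is nonzero.\<close>

lemma digits_val_ge:
  assumes "u \<noteq> []" "hd u \<ge> 1" shows "digits_val B u \<ge> B ^ (length u - 1)"
proof -
  obtain a v where u: "u = [a] @ v" using assms(1) by (cases u) auto
  show ?thesis using assms(2) unfolding u digits_val_append by (simp add: digits_val_def trans_le_add1)
qed

lemma digits_val_mod_suffix:
  assumes "\<forall>a\<in>set v. a < B"
  shows "digits_val B (u @ v) mod B ^ length v = digits_val B v"
  using digits_val_less[OF assms] by (simp add: digits_val_append)

text \<open>Padding with zeros to a common length turns the lexicographic order into the numerical one,
  since no digit of the strings themselves is \<open>0\<close>.\<close>

lemma digits_val_mono_lex:
  assumes "u < v" "length u \<le> m" "length v \<le> m"
    "\<forall>a\<in>set u. a < B" "\<forall>a\<in>set v. 0 < a \<and> a < B"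
  shows "digits_val B u * B ^ (m - length u) < digits_val B v * B ^ (m - length v)"
  using assms
proof (induction u arbitrary: v m)
  case Nil
  then obtain a w where v: "v = a # w" by (cases v) auto
  then have "B ^ (length v - 1) \<le> digits_val B v" using Nil by (intro digits_val_ge) auto
  moreover have "0 < B" using Nil v by auto
  ultimately show ?case by (simp add: digits_val_Nil) (metis gr0I not_le power_eq_0_iff)
next
  case (Cons a u)
  then obtain b w where v: "v = b # w" by (cases v) auto
  have val: "digits_val B (x # xs) * B ^ (m - length (x # xs))
      = x * B ^ (m - 1) + digits_val B xs * B ^ (m - 1 - length xs)" if "length xs < m" for x xs
  proof -
    have "B ^ length xs * B ^ (m - Suc (length xs)) = B ^ (m - 1)"
      using that by (simp flip: power_add)
    then show ?thesis
      using digits_val_append[of B "[x]" xs] by (simp add: digits_val_def algebra_simps)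
  qed
  from Cons.prems(1) v consider "a < b" | "a = b" "u < w" by auto
  then show ?case
  proof cases
    case 1
    have "digits_val B u < B ^ length u" using Cons.prems by (intro digits_val_less) auto
    moreover have "0 < B" using Cons.prems by auto
    ultimately have "digits_val B u * B ^ (m - 1 - length u) < B ^ length u * B ^ (m - 1 - length u)"
      by simp
    also have "\<dots> = B ^ (m - 1)" using Cons.prems by (simp flip: power_add)
    finally have "a * B ^ (m - 1) + digits_val B u * B ^ (m - 1 - length u) < Suc a * B ^ (m - 1)"
      by simp
    also have "\<dots> \<le> b * B ^ (m - 1)" using 1 by (intro mult_right_mono) auto
    finally show ?thesis using Cons.prems v val[of u a] val[of w b] by simp
  next
    case 2
    have "digits_val B u * B ^ (m - 1 - length u) < digits_val B w * B ^ (m - 1 - length w)"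
      using Cons.prems v 2 by (intro Cons.IH) auto
    then show ?thesis using 2 Cons.prems v val[of u a] val[of w b] by simp
  qed
qed

section \<open>Minimal suffixes under a change of letters and in terms of digit values\<close>

lemma finite_suffixes: "finite {u. suffix u v \<and> u \<noteq> []}"
  by (rule finite_subset[of _ "set (suffixes v)"]) auto

lemma min_suffixI:
  assumes "suffix u v" "u \<noteq> []" "\<And>w. suffix w v \<Longrightarrow> w \<noteq> [] \<Longrightarrow> u \<le> w"
  shows "min_suffix v = u"
  unfolding min_suffix_def using assms finite_suffixes by (intro Min_eqI) auto

lemma min_suffix_props:
  assumes "v \<noteq> []"
  shows "suffix (min_suffix v) v" "min_suffix v \<noteq> []"
    "suffix w v \<Longrightarrow> w \<noteq> [] \<Longrightarrow> min_suffix v \<le> w"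
proof -
  have "min_suffix v \<in> {u. suffix u v \<and> u \<noteq> []}"
    unfolding min_suffix_def using assms by (intro Min_in finite_suffixes) auto
  then show "suffix (min_suffix v) v" "min_suffix v \<noteq> []" by auto
  show "suffix w v \<Longrightarrow> w \<noteq> [] \<Longrightarrow> min_suffix v \<le> w"
    unfolding min_suffix_def using finite_suffixes by (intro Min_le) auto
qed

lemma map_mono_lex:
  fixes f :: "'a::linorder \<Rightarrow> 'b::linorder"
  assumes "strict_mono_on A f" "set u \<subseteq> A" "set v \<subseteq> A" "u < v"
  shows "map f u < map f v"
  using assms(2-)
proof (induction u arbitrary: v)
  case Nil
  then show ?case by (cases v) auto
next
  case (Cons a u)
  then obtain b w where "v = b # w" by (cases v) auto
  with Cons show ?case using strict_mono_onD[OF assms(1)] by auto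
qed

text \<open>A strictly monotone map of the letters preserves every comparison of two suffixes, hence
  carries the least one to the least one. With the rank as the map, this justifies storing ranks in
  place of letters.\<close>

lemma min_suffix_map:
  fixes f :: "'a::linorder \<Rightarrow> 'b::linorder"
  assumes "strict_mono_on (set v) f" "v \<noteq> []"
  shows "min_suffix (map f v) = map f (min_suffix v)"
proof (rule min_suffixI)
  note p = min_suffix_props[OF assms(2)]
  show "suffix (map f (min_suffix v)) (map f v)" using p(1) by (rule map_mono_suffix)
  show "map f (min_suffix v) \<noteq> []" using p(2) by simp
  fix w assume w: "suffix w (map f v)" "w \<noteq> []"
  then obtain w' where w': "suffix w' v" "w = map f w'"
    by (metis map_eq_append_conv suffix_def)
  then have "min_suffix v \<le> w'" using p(3) w by auto
  then show "map f (min_suffix v) \<le> w"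
    using map_mono_lex[OF assms(1) set_mono_suffix[OF p(1)] set_mono_suffix[OF w'(1)]] w'(2)
    by (auto simp: le_less)
qed

text \<open>The criterion that the table program evaluates: the remainder modulo
  \<open>B ^ j\<close> is the suffix of length \<open>j\<close>, and the factor
  \<open>B ^ (m - j)\<close> pads it to \<open>m\<close> digits. A lexicographically smaller suffix
  would have a smaller padded value, against the choice of \<open>j\<close>.\<close>

lemma length_min_suffix_eq:
  assumes u: "u \<noteq> []" "\<forall>a\<in>set u. 0 < a \<and> a < B" "length u \<le> m"
    and j: "1 \<le> j" "j \<le> length u"
    and least: "\<And>i. 1 \<le> i \<Longrightarrow> i \<le> length u \<Longrightarrow>
      digits_val B u mod B ^ j * B ^ (m - j) \<le> digits_val B u mod B ^ i * B ^ (m - i)"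
  shows "length (min_suffix u) = j"
proof -
  let ?s = "\<lambda>i. drop (length u - i) u"
  have s: "length (?s i) = i" "set (?s i) \<subseteq> set u" "digits_val B u mod B ^ i = digits_val B (?s i)"
    if "i \<le> length u" for i
  proof -
    show 1: "length (?s i) = i" using that by simp
    show 2: "set (?s i) \<subseteq> set u" by (rule set_drop_subset)
    show "digits_val B u mod B ^ i = digits_val B (?s i)"
      using digits_val_mod_suffix[of "?s i" B "take (length u - i) u"] 1 2 u(2) by auto
  qed
  have "min_suffix u = ?s j"
  proof (rule min_suffixI)
    show "suffix (?s j) u" by (rule suffix_drop)
    show "?s j \<noteq> []" using j by auto
    fix w assume "suffix w u" "w \<noteq> []"
    define i where "i = length w"
    have i: "1 \<le> i" "i \<le> length u"
      using \<open>suffix w u\<close> \<open>w \<noteq> []\<close> by (auto simp: i_def Suc_le_eq suffix_length_le)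
    have w: "w = ?s i" using \<open>suffix w u\<close> by (auto simp: i_def suffix_def)
    show "?s j \<le> w"
    proof (rule ccontr)
      assume "\<not> ?s j \<le> w"
      then have "digits_val B (?s i) * B ^ (m - length (?s i)) < digits_val B (?s j) * B ^ (m - length (?s j))"
        using s[OF i(2)] s[OF j(2)] u i j unfolding w
        by (intro digits_val_mono_lex) (auto simp: subset_iff)
      with least[OF i] s[OF i(2)] s[OF j(2)] show False by simp
    qed
  qed
  with s[OF j(2)] show ?thesis by simp
qed

section \<open>Packed numbers, digits counted from the least significant one\<close>

lemma sum_digits_less:
  assumes "\<And>i. i < N \<Longrightarrow> f i < (B::nat)"
  shows "(\<Sum>i<N. f i * B ^ i) < B ^ N"
  using assms
proof (induction N)
  case (Suc N)
  then have "(\<Sum>i<N. f i * B ^ i) < B ^ N" by simp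
  moreover have "Suc (f N) * B ^ N \<le> B * B ^ N" using Suc.prems[of N] by (intro mult_right_mono) auto
  ultimately show ?case by simp
qed simp

text \<open>Division drops the \<open>k\<close> low digits and the remainder keeps the next
  \<open>l\<close>; a query cuts a fragment out of a cell in this way.\<close>

lemma sum_digits_div_mod:
  assumes "\<And>i. i < N \<Longrightarrow> f i < (B::nat)" "k + l \<le> N"
  shows "(\<Sum>i<N. f i * B ^ i) div B ^ k mod B ^ l = (\<Sum>i<l. f (k + i) * B ^ i)"
proof -
  have split: "(\<Sum>i<a + c. g i * B ^ i) = (\<Sum>i<a. g i * B ^ i) + B ^ a * (\<Sum>i<c. g (a + i) * B ^ i)"
    for a c g
    by (induction c) (simp_all add: power_add algebra_simps sum_distrib_left)
  obtain c where N: "N = k + (l + c)" using assms(2) by (metis add.assoc le_Suc_ex)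
  have 1: "(\<Sum>i<k. f i * B ^ i) < B ^ k" using assms N by (intro sum_digits_less) auto
  have 2: "(\<Sum>i<l. f (k + i) * B ^ i) < B ^ l" using assms N by (intro sum_digits_less) auto
  have "(\<Sum>i<N. f i * B ^ i) div B ^ k = (\<Sum>i<l + c. f (k + i) * B ^ i)"
    unfolding N split[where a=k] using 1 by (subst div_mult_self2) (linarith, simp)
  then show ?thesis using 2 unfolding split[where a=l] by simp
qed

section \<open>Building the structure\<close>

text \<open>
  Registers of the construction: 0, 2 hold \<open>n\<close>, \<open>\<tau>\<close>; 3, 4, 5, 18 the constants \<open>1\<close>, \<open>0\<close>, \<open>2\<close>, \<open>5\<close>;
  6 to 9 hold \<open>2\<tau>\<close>, \<open>b\<close>, \<open>2\<^sup>b\<close> and the table size \<open>2\<^bsup>b\<tau>\<^esup>\<close>; 11 the number of ranks per cell; 12 to 14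
  the addresses of rows 2 to 4; 15, 16, 17 those of the structure, its table and its cells; 19 the
  power of \<open>n\<close> that selects the current digit of the radix sort. Registers from 20 on are scratch.

  Memory is used as a matrix, address \<open>c * n + i\<close> being column \<open>i < n\<close> of row \<open>c\<close>: row 0 is the text, row 1
  the list of positions being sorted, row 2 the bucket sizes, row 3 the last letter met by each
  window (plus one), row 4 the number of distinct letters met by it, row \<open>5 + g\<close> the bucket
  of digit \<open>g\<close>. The structure is placed at \<open>n\<^sup>3\<close>, beyond all rows; that memory is initially
  zero is used for rows 2 to 4 and for the cells.
\<close>

definition "setup_head = seqs [
  Instr (Const 5 2), Instr (Const 18 5), Instr (Const 4 0), Instr (Op Add 6 2 2),
  Instr (Const 7 0), Instr (Const 8 1)]"

definition "setup_mid = seqs [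
  Instr (Op Mul 20 7 2), Instr (Op Shl 9 3 20), Instr (Op Mul 10 9 9),
  Instr (Const 11 0), Instr (Op Add 21 10 4)]"

definition "setup_tail = seqs [
  Instr (Op Mul 11 11 6), Instr (Op Add 12 0 0), Instr (Op Add 13 12 0), Instr (Op Add 14 13 0),
  Instr (Op Mul 15 0 0), Instr (Op Mul 15 15 0), Instr (Const 20 4), Instr (Op Add 16 15 20),
  Instr (Op Add 17 16 9), Instr (Const 19 1), Instr (Const 20 0)]"

definition "setup_prog = seqs [
  setup_head,
  While Le 8 6 (seqs [Instr (Op Add 8 8 8), Instr (Op Add 7 7 3)]),
  setup_mid,
  While Le 21 0 (seqs [Instr (Op Mul 21 21 10), Instr (Op Add 11 11 3)]),
  setup_tail,
  While Lt 20 0 (seqs [Instr (Op Add 21 0 20), Instr (Store 21 20), Instr (Op Add 20 20 3)])]"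

definition "distribute_body = seqs [
  Instr (Op Add 21 0 20), Instr (Load 21 21), Instr (Load 22 21), Instr (Op Div 22 22 19),
  Instr (Op Mod 22 22 0), Instr (Op Add 23 12 22), Instr (Load 24 23), Instr (Op Add 25 22 18),
  Instr (Op Mul 25 25 0), Instr (Op Add 25 25 24), Instr (Store 25 21), Instr (Op Add 24 24 3),
  Instr (Store 23 24), Instr (Op Add 20 20 3)]"

text \<open>Registers 25 and 27 delimit the unread part of the bucket, and 26 is the write position
  in row 1, which runs on from bucket to bucket. \<open>Store 23 4\<close> clears the bucket size
  for the next pass.\<close>

definition "collect_body = seqs [
  Instr (Op Add 23 12 20), Instr (Load 24 23), Instr (Op Add 25 20 18), Instr (Op Mul 25 25 0),
  Instr (Op Add 27 25 24),
  While Lt 25 27 (seqs [Instr (Load 21 25), Instr (Store 26 21), Instr (Op Add 25 25 3),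
    Instr (Op Add 26 26 3)]),
  Instr (Store 23 4), Instr (Op Add 20 20 3)]"

definition "pass_prog = seqs [
  Instr (Const 20 0), While Lt 20 0 distribute_body,
  Instr (Const 20 0), Instr (Op Add 26 0 4), While Lt 20 0 collect_body,
  Instr (Op Mul 19 19 0)]"

text \<open>\<open>bw\<close> is the word length in bits, \<open>b\<close> the number of bits of a
  rank and \<open>P\<close> the number of windows in a cell. The two-sided bounds determine
  \<open>b\<close> and \<open>P\<close>: each is where a loop of the setup stops. In
  \<open>n ^ (k + 6)\<close>, the factor \<open>n ^ k\<close> accommodates letters and the powers of
  \<open>n\<close> that select digits, the rest is a margin for addresses beyond
  \<open>n ^ 3\<close> and for intermediate products.\<close>

locale min_suffix_params =
  fixes bw k n \<tau> b P :: nat and T :: "nat list"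
  assumes length_T: "length T = n"
    and T_less: "\<And>i. i < n \<Longrightarrow> T ! i < n ^ k"
    and word_large: "n ^ (k + 6) \<le> 2 ^ bw"
    and n_ge: "16 \<le> n" and \<tau>_ge: "2 \<le> \<tau>"
    and b_gt: "2 * \<tau> < 2 ^ b" and b_le: "2 ^ b \<le> 4 * \<tau>"
    and P_ge: "1 \<le> P" and P_le: "2 ^ (b * (P * (2 * \<tau>))) \<le> n"
    and P_gt: "n < 2 ^ (b * (Suc P * (2 * \<tau>)))"
begin

section \<open>Numerical bounds against overflow and overlapping memory\<close>

definition "full = (2::nat) ^ (b * \<tau>)"
definition "slots = P * (2 * \<tau>)"
definition "Db = n ^ 3"

lemma full_sq: "full * full \<le> n"
proof -
  have "full * full = 2 ^ (b * (1 * (2 * \<tau>)))"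
    unfolding full_def by (simp flip: power_add add: algebra_simps)
  also have "\<dots> \<le> 2 ^ (b * (P * (2 * \<tau>)))"
    using P_ge by (intro power_increasing mult_left_mono mult_right_mono) auto
  finally show ?thesis using P_le by simp
qed

lemma b_pos: "0 < b" using b_gt \<tau>_ge by (cases b) auto

lemma exp_slots: "2 ^ (b * slots) \<le> n"
  using P_le by (simp add: slots_def)

lemma b_slots_less: "b * slots < n"
  using less_exp[of "b * slots"] exp_slots by linarith

lemma slots_pos: "0 < slots" using P_ge \<tau>_ge by (simp add: slots_def)

lemma slots_less: "slots < n"
  using b_slots_less b_pos slots_pos by (metis le_less_trans mult_le_mono1 One_nat_def Suc_leI mult_1)

lemma b_less: "b < n"
  using b_slots_less b_pos slots_pos by (metis le_less_trans mult_le_mono2 One_nat_def Suc_leI mult_1_right)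

lemma \<tau>_bound: "2 * \<tau> \<le> slots" using P_ge by (simp add: slots_def)

lemma \<tau>_less: "2 * \<tau> < n" using slots_less \<tau>_bound by linarith

lemma P_less: "P < n"
proof -
  have "P * 1 \<le> slots" unfolding slots_def using \<tau>_ge by (intro mult_left_mono) auto
  then show ?thesis using slots_less by simp
qed

lemma full_gt: "2 * \<tau> < full"
proof -
  have "(2::nat) ^ b \<le> 2 ^ (b * \<tau>)" using \<tau>_ge by (intro power_increasing) auto
  then show ?thesis using b_gt unfolding full_def by linarith
qed

lemma full_less: "full < n"
proof -
  have "full * 2 \<le> full * full" using full_gt \<tau>_ge by (intro mult_left_mono) auto
  then show ?thesis using full_sq full_gt by linarith
qed

lemma \<tau>_full: "\<tau> * full \<le> n"
  by (rule order_trans[OF _ full_sq]) (use full_gt in \<open>auto intro!: mult_right_mono\<close>)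

lemma pow_less_word: assumes "j \<le> k" shows "n ^ j * n ^ 5 < 2 ^ bw"
proof -
  have "n ^ j * n ^ 5 = n ^ (j + 5)" by (simp add: power_add)
  also have "\<dots> < n ^ (k + 6)" using n_ge assms by (intro power_strict_increasing) auto
  finally show ?thesis using word_large by linarith
qed

lemma T_less_word:
  assumes "i < n" shows "Suc (T ! i) < 2 ^ bw" "T ! i div m < 2 ^ bw"
proof -
  have "n ^ k * 2 \<le> n ^ k * n ^ 5"
    using n_ge self_le_power[of n 5] by (intro mult_left_mono) linarith+
  then show *: "Suc (T ! i) < 2 ^ bw" using T_less[OF assms] pow_less_word[of k] by linarith
  show "T ! i div m < 2 ^ bw" using * div_le_dividend[of "T ! i" m] by linarith
qed

text \<open>With \<open>16 * Db \<le> n ^ 4\<close>, rough estimates by small multiples of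
  \<open>Db\<close> are enough to keep slot numbers and addresses inside a word.\<close>

lemma Db_bound: "Db + n ^ 4 < 2 ^ bw" "16 * Db \<le> n ^ 4"
proof -
  have "Db + n ^ 4 \<le> n ^ 4 + n ^ 4" unfolding Db_def using n_ge by (intro add_right_mono power_increasing) auto
  also have "\<dots> \<le> n ^ 5" using n_ge mult_le_mono1[of 2 n "n ^ 4"] by (simp add: numeral_eq_Suc)
  also have "\<dots> < 2 ^ bw" using pow_less_word[of 0] by simp
  finally show "Db + n ^ 4 < 2 ^ bw" .
  show "16 * Db \<le> n ^ 4" unfolding Db_def using n_ge mult_le_mono1[of 16 n "n ^ 3"] by (simp add: numeral_eq_Suc)
qed

text \<open>The matrix has \<open>n + 5\<close> rows of length \<open>n\<close>; for
  \<open>n \<ge> 16\<close> they end before the structure begins.\<close>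

lemma Db_ge: "(n + 10) * n \<le> Db" "n * n * n = Db"
proof -
  have "n + 10 \<le> 16 * n" using n_ge by simp
  also have "\<dots> \<le> n * n" using n_ge by (intro mult_right_mono) auto
  finally have "(n + 10) * n \<le> n * n * n" by (rule mult_right_mono) simp
  then show "(n + 10) * n \<le> Db" by (simp add: Db_def power3_eq_cube)
  show "n * n * n = Db" by (simp add: Db_def power3_eq_cube)
qed

lemma Db_ge': "26 * n \<le> Db"
  using Db_ge(1) mult_le_mono1[of 26 "n + 10" n] n_ge by linarith

lemmas bounds = Db_bound Db_ge' Db_ge(1) n_ge \<tau>_ge full_less full_gt slots_less \<tau>_less b_less P_less

definition "consts R \<longleftrightarrow> R (0::nat) = n \<and> R 2 = \<tau> \<and> R 3 = 1 \<and> R 4 = (0::nat) \<and> R 5 = 2 \<and> R 6 = 2 * \<tau> \<and>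
  R 7 = b \<and> R 8 = 2 ^ b \<and> R 9 = full \<and> R 11 = slots \<and> R 12 = 2 * n \<and> R 13 = 3 * n \<and>
  R 14 = 4 * n \<and> R 15 = Db \<and> R 16 = Db + 4 \<and> R 17 = Db + 4 + full \<and> R 18 = 5"

text \<open>Nothing is said about the bucket rows: they keep stale entries of earlier passes, and
  only the part covered by the bucket sizes is ever read. Rows 3 and 4 and the cells from
  \<open>Db\<close> on must survive the sort as zeros.\<close>

definition "perm_inv xs M \<longleftrightarrow> mset xs = mset [0..<n] \<and>
  (\<forall>i<n. M i = T ! i) \<and> (\<forall>i<n. M (n + i) = xs ! i) \<and> (\<forall>i<n. M (2 * n + i) = 0) \<and>
  (\<forall>a. 3 * n \<le> a \<and> a < 5 * n \<or> Db \<le> a \<longrightarrow> M a = 0)"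

section \<open>Initialisation\<close>

lemma wp_setup:
  assumes "R 0 = n" "R 2 = \<tau>" "R 3 = 1" "M = nth_default 0 T"
  shows "wp bw setup_prog (20 * n) (\<lambda>(R, M). consts R \<and> R 19 = 1 \<and> perm_inv [0..<n] M) (R, M)"
proof -
  note [simp] = assms(1-3)
  define I1 where "I1 = (\<lambda>i (R :: reg \<Rightarrow> nat, M). R 0 = n \<and> R 2 = \<tau> \<and> R 3 = 1 \<and> R 4 = 0 \<and> R 5 = 2 \<and>
    R 6 = 2 * \<tau> \<and> R 18 = 5 \<and> R 7 = i \<and> R 8 = 2 ^ i \<and> M = nth_default 0 T)"
  define I2 where "I2 = (\<lambda>i (R :: reg \<Rightarrow> nat, M). R 0 = n \<and> R 2 = \<tau> \<and> R 3 = 1 \<and> R 4 = 0 \<and> R 5 = 2 \<and>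
    R 6 = 2 * \<tau> \<and> R 18 = 5 \<and> R 7 = b \<and> R 8 = 2 ^ b \<and> R 9 = full \<and> R 10 = full * full \<and> R 11 = i \<and>
    R 21 = (full * full) ^ Suc i \<and> M = nth_default 0 T)"
  define I3 where "I3 = (\<lambda>i (R, M). consts R \<and> R 19 = 1 \<and> R 20 = i \<and>
    M = (\<lambda>a. if n \<le> a \<and> a < n + i then a - n else nth_default 0 T a))"
  \<comment> \<open>The doubling loop stops exactly at \<open>b\<close>, since
    \<open>2 ^ b \<le> 4 * \<tau>\<close> keeps every smaller power within
    \<open>2 * \<tau>\<close>.\<close>
  have pow_b: "(2::nat) ^ i \<le> 2 * \<tau> \<longleftrightarrow> i < b" if "i \<le> b" for i
  proof (cases "i = b")
    case False
    then have "(2::nat) ^ Suc i \<le> 2 ^ b" using that by (intro power_increasing) auto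
    then show ?thesis using b_le False that by simp
  qed (use b_gt in simp)
  have full_pow: "(full * full) ^ i = 2 ^ (b * (i * (2 * \<tau>)))" for i
    unfolding full_def by (simp flip: power_mult power_add add: algebra_simps)
  have pow_P: "(full * full) ^ Suc i \<le> n \<longleftrightarrow> i < P" if "i \<le> P" for i
  proof (cases "i = P")
    case False
    then have "(2::nat) ^ (b * (Suc i * (2 * \<tau>))) \<le> 2 ^ (b * (P * (2 * \<tau>)))"
      using that by (intro power_increasing mult_left_mono mult_right_mono) auto
    then show ?thesis using P_le False that unfolding full_pow by linarith
  qed (use P_gt full_pow[of "Suc P"] in \<open>simp del: power_Suc\<close>)
  have L1: "wp bw (While Le 8 6 (seqs [Instr (Op Add 8 8 8), Instr (Op Add 7 7 3)])) (4 * b + 1) (I1 b) s"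
    if "I1 0 s" for s
  proof (rule wp_While[where I = I1 and N = b and f = "\<lambda>_. 3"])
    fix i s assume i: "i < b" and I: "I1 i s"
    obtain R M where s: "s = (R, M)" by fastforce
    show "cmp_holds Le (fst s 8) (fst s 6)" using I pow_b[of i] i unfolding s I1_def by simp
    have "(2::nat) ^ i + 2 ^ i < 2 ^ bw" using pow_b[of i] i bounds by linarith
    then show "wp bw (seqs [Instr (Op Add 8 8 8), Instr (Op Add 7 7 3)]) 3 (I1 (Suc i)) s"
      using I i bounds unfolding s I1_def by (simp add: wp_simps)
  next
    fix s assume "I1 b s"
    then show "\<not> cmp_holds Le (fst s 8) (fst s 6)" using pow_b[of b] unfolding I1_def by (cases s) auto
  qed (use that in auto)
  have L2: "wp bw (While Le 21 0 (seqs [Instr (Op Mul 21 21 10), Instr (Op Add 11 11 3)])) (4 * P + 1) (I2 P) s"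
    if "I2 0 s" for s
  proof (rule wp_While[where I = I2 and N = P and f = "\<lambda>_. 3"])
    fix i s assume i: "i < P" and I: "I2 i s"
    obtain R M where s: "s = (R, M)" by fastforce
    show "cmp_holds Le (fst s 21) (fst s 0)" using I pow_P[of i] i unfolding s I2_def by simp
    \<comment> \<open>The last product exceeds \<open>n\<close> and stops the loop, but one factor
      too many costs no more than another \<open>n\<close>.\<close>
    have "(full * full) ^ Suc i * (full * full) \<le> n * n"
      using pow_P[of i] i full_sq by (intro mult_mono) auto
    also have "\<dots> \<le> (n + 10) * n" by simp
    finally have "(full * full) ^ Suc i * (full * full) < 2 ^ bw" using bounds by linarith
    then show "wp bw (seqs [Instr (Op Mul 21 21 10), Instr (Op Add 11 11 3)]) 3 (I2 (Suc i)) s"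
      using I i bounds unfolding s I2_def by (simp add: wp_simps mult_ac)
  next
    fix s assume "I2 P s"
    then show "\<not> cmp_holds Le (fst s 21) (fst s 0)" using pow_P[of P] unfolding I2_def by (cases s) auto
  qed (use that in auto)
  have L3: "wp bw (While Lt 20 0 (seqs [Instr (Op Add 21 0 20), Instr (Store 21 20), Instr (Op Add 20 20 3)]))
      (5 * n + 1) (I3 n) s"
    if "I3 0 s" for s
  proof (rule wp_While[where I = I3 and N = n and f = "\<lambda>_. 4"])
    fix i s assume i: "i < n" and I: "I3 i s"
    obtain R M where s: "s = (R, M)" by fastforce
    show "cmp_holds Lt (fst s 20) (fst s 0)" using I i unfolding s I3_def consts_def by simp
    show "wp bw (seqs [Instr (Op Add 21 0 20), Instr (Store 21 20), Instr (Op Add 20 20 3)]) 4 (I3 (Suc i)) s"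
      using I i bounds unfolding s I3_def consts_def by (auto simp add: wp_simps fun_eq_iff)
  next
    fix s assume "I3 n s"
    then show "\<not> cmp_holds Lt (fst s 20) (fst s 0)" unfolding I3_def consts_def by (cases s) auto
  qed (use that in auto)
  have fin: "perm_inv [0..<n] M" if "I3 n (R, M)" for R M
    using that bounds length_T unfolding I3_def perm_inv_def by (auto simp: nth_default_def)
  have bt: "b * \<tau> < n" using b_slots_less \<tau>_bound mult_le_mono2[of \<tau> slots b] by linarith
  have n2: "n * n \<le> Db" using Db_ge(1) by (simp add: algebra_simps)
  have A: "wp bw setup_head 6 (I1 0) (R, M)"
    unfolding setup_head_def I1_def using bounds assms(4) by (simp add: wp_simps)
  have B: "wp bw setup_mid 5 (I2 0) s" if "I1 b s" for s
    using that bounds bt full_sq unfolding setup_mid_def I1_def I2_def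
    by (cases s) (simp add: wp_simps full_def[symmetric])
  have C: "wp bw setup_tail 11 (I3 0) s" if "I2 P s" for s
    using that bounds n2 unfolding setup_tail_def I2_def I3_def
    by (cases s) (simp add: wp_simps consts_def slots_def[symmetric] Db_ge(2) fun_eq_iff)
  have "wp bw setup_prog (6 + (4 * b + 1 + (5 + (4 * P + 1 + (11 + (5 * n + 1 + 0)))))) (I3 n) (R, M)"
    unfolding setup_prog_def seqs.simps
    by (rule wp_SeqI'[OF A], rule wp_SeqI'[OF L1[unfolded seqs.simps]], assumption, rule wp_SeqI'[OF B], assumption,
        rule wp_SeqI'[OF L2[unfolded seqs.simps]], assumption, rule wp_SeqI'[OF C], assumption, rule wp_SeqI'[OF L3[unfolded seqs.simps]], assumption)
      (simp_all only: wp_Skip)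
  then show ?thesis
    by (rule wp_mono) (use bounds fin I3_def in auto)
qed


section \<open>The radix sort in memory\<close>

definition "digit j p = T ! p div n ^ j mod n"
definition "bucket j xs g = filter (\<lambda>p. digit j p = g) xs"

definition "frame_zero M \<longleftrightarrow> (\<forall>a. 3 * n \<le> a \<and> a < 5 * n \<or> Db \<le> a \<longrightarrow> M a = (0::nat))"

definition "buckets_inv bk M \<longleftrightarrow> (\<forall>i<n. M i = T ! i) \<and> frame_zero M \<and>
  (\<forall>g<n. \<forall>i<length (bk g). M ((g + 5) * n + i) = (bk g ! i :: nat))"

lemma row_inj:
  fixes g g' i i' :: nat
  assumes "i < n" "i' < n"
  shows "g * n + i = g' * n + i' \<longleftrightarrow> g = g' \<and> i = i'"
proof
  assume *: "g * n + i = g' * n + i'"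
  have "(g * n + i) div n = g" "(g * n + i) mod n = i" "(g' * n + i') div n = g'" "(g' * n + i') mod n = i'"
    using assms by auto
  with * show "g = g' \<and> i = i'" by metis
qed auto

lemma row_bounds:
  assumes "g < n" "i < n" shows "5 * n \<le> (g + 5) * n + i" "(g + 5) * n + i < Db"
proof -
  show "5 * n \<le> (g + 5) * n + i" by (simp add: algebra_simps)
  have "(g + 6) * n \<le> (n + 10) * n" using assms by (intro mult_right_mono) auto
  then show "(g + 5) * n + i < Db" using Db_ge(1) assms(2) by (simp add: algebra_simps)
qed

lemma wp_distribute:
  assumes xs: "mset xs = mset [0..<n]"
    and s: "consts (fst s)" "fst s 19 = n ^ j" "fst s 20 = 0" "perm_inv xs (snd s)"
  shows "wp bw (While Lt 20 0 distribute_body) (15 * n + 1)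
    (\<lambda>(R, M). consts R \<and> R 19 = n ^ j \<and> buckets_inv (bucket j xs) M \<and>
      (\<forall>g<n. M (2 * n + g) = length (bucket j xs g))) s"
proof -
  have len: "length xs = n" using mset_eq_length[OF xs] by simp
  have el: "xs ! i < n" if "i < n" for i
    using mset_eq_setD[OF xs] len that nth_mem[of i xs] by auto
  define I where "I = (\<lambda>i (R, M). consts R \<and> R 19 = n ^ j \<and> R 20 = i \<and>
    buckets_inv (bucket j (take i xs)) M \<and> (\<forall>i<n. M (n + i) = xs ! i) \<and>
    (\<forall>g<n. M (2 * n + g) = length (bucket j (take i xs) g)))"
  show ?thesis
  proof (rule wp_While[where I = I and N = n and f = "\<lambda>_. 14"])
    fix i s assume i: "i < n" and I: "I i s"
    obtain R M where s: "s = (R, M)" by fastforce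
    show "cmp_holds Lt (fst s 20) (fst s 0)" using I i unfolding s I_def consts_def by simp
    define p where "p = xs ! i"
    define g where "g = digit j p"
    define bk where "bk = bucket j (take i xs)"
    define c where "c = length (bk g)"
    have p: "p < n" using el[OF i] by (simp add: p_def)
    have g: "g < n" using n_ge by (simp add: g_def digit_def)
    have c: "c < n"
      using length_filter_le[of "\<lambda>p. digit j p = g" "take i xs"] i by (simp add: c_def bk_def bucket_def)
    have M: "M (n + i) = p" "M p = T ! p" "M (2 * n + g) = c"
      using I i p g by (auto simp: s I_def buckets_inv_def p_def c_def bk_def)
    have tp: "T ! p < 2 ^ bw" "T ! p div n ^ j < 2 ^ bw"
      using T_less_word[OF p] by (simp_all add: Suc_lessD)
    have gt: "T ! p div n ^ j mod n = g" by (simp add: g_def digit_def)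
    define a where "a = (g + 5) * n + c"
    have a: "5 * n \<le> a" "a < Db" using row_bounds[OF g c] by (simp_all add: a_def)
    have a': "(g + 5) * n + c = a" "(g + 5) * n \<le> a" by (simp_all add: a_def)
    have R: "consts R" "R 19 = n ^ j" "R 20 = i" using I by (auto simp: s I_def)
    define M' where "M' = M(a := p, 2 * n + g := Suc c)"
    define R' where "R' = R(21 := p, 22 := g, 23 := 2 * n + g, 25 := a, 24 := Suc c, 20 := Suc i)"
    have upd: "bucket j (take (Suc i) xs) = bk(g := bk g @ [p])"
      using i len by (auto simp: bucket_def bk_def take_Suc_conv_app_nth p_def g_def fun_eq_iff)
    have cntM: "\<forall>g'<n. M (2 * n + g') = length (bk g')" and xsM: "\<forall>i<n. M (n + i) = xs ! i"
      and bM: "buckets_inv bk M"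
      using I by (auto simp: s I_def bk_def)
    have "consts R'" "R' 19 = n ^ j" "R' 20 = Suc i" using R by (auto simp: R'_def consts_def)
    moreover have "\<forall>i<n. M' (n + i) = xs ! i" using xsM a by (auto simp: M'_def)
    moreover have "\<forall>g'<n. M' (2 * n + g') = length (bucket j (take (Suc i) xs) g')"
      using cntM a unfolding upd by (auto simp: M'_def c_def)
    moreover have "buckets_inv (bucket j (take (Suc i) xs)) M'"
      unfolding buckets_inv_def
    proof (intro conjI allI impI)
      show "M' i' = T ! i'" if "i' < n" for i'
        using bM that a g by (auto simp: M'_def buckets_inv_def)
      show "frame_zero M'"
        using bM a g bounds by (auto simp: M'_def buckets_inv_def frame_zero_def)
      fix g' i' assume g': "g' < n" and i': "i' < length (bucket j (take (Suc i) xs) g')"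
      have "length (bucket j (take (Suc i) xs) g') \<le> Suc i"
        using length_filter_le[of "\<lambda>p. digit j p = g'" "take (Suc i) xs"] by (simp add: bucket_def)
      then have "i' < n" using i i' by linarith
      have "(g' + 5) * n + i' = a \<longleftrightarrow> g' = g \<and> i' = c"
        unfolding a_def using row_inj[OF \<open>i' < n\<close> c, of "g' + 5" "g + 5"] by simp
      moreover have "(g' + 5) * n + i' \<noteq> 2 * n + g" using row_bounds(1)[OF g' \<open>i' < n\<close>] g by linarith
      moreover have "M ((g' + 5) * n + i') = bk g' ! i'" if "i' < length (bk g')"
        using bM g' that by (auto simp: buckets_inv_def)
      ultimately show "M' ((g' + 5) * n + i') = bucket j (take (Suc i) xs) g' ! i'"
        using i' unfolding upd M'_def by (auto simp: c_def nth_append less_Suc_eq split: if_splits)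
    qed
    ultimately have "I (Suc i) (R', M')" by (simp add: I_def)
    then show "wp bw distribute_body 14 (I (Suc i)) s"
      using R M tp gt a a' bounds i p g c unfolding s distribute_body_def
      by (simp add: wp_simps consts_def R'_def M'_def)
  next
    fix s assume "I n s"
    then show "\<not> cmp_holds Lt (fst s 20) (fst s 0)" unfolding I_def consts_def by (cases s) auto
  next
    show "I 0 s" using s unfolding I_def
      by (cases s) (auto simp: buckets_inv_def bucket_def perm_inv_def frame_zero_def)
  next
    fix s assume "I n s"
    then show "case s of (R, M) \<Rightarrow> consts R \<and> R 19 = n ^ j \<and> buckets_inv (bucket j xs) M \<and>
      (\<forall>g<n. M (2 * n + g) = length (bucket j xs g))"
      using len by (cases s) (simp add: I_def)
  qed simp
qed


text \<open>Emptying one bucket takes time proportional to its length plus a constant. As the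
  buckets together are a permutation of the positions, their lengths add up to \<open>n\<close>, so
  the nested loops cost \<open>14 * n\<close> in all and not \<open>n * n\<close>.\<close>

lemma wp_collect:
  fixes bk :: "nat \<Rightarrow> nat list"
  assumes perm: "mset (concat (map bk [0..<n])) = mset [0..<n]"
    and s: "consts (fst s)" "fst s 19 = n ^ j" "fst s 20 = 0" "fst s 26 = n"
      "buckets_inv bk (snd s)" "\<forall>g<n. snd s (2 * n + g) = length (bk g)"
  shows "wp bw (While Lt 20 0 collect_body) (14 * n + 1)
    (\<lambda>(R, M). consts R \<and> R 19 = n ^ j \<and> perm_inv (concat (map bk [0..<n])) M) s"
proof -
  define ys where "ys g = concat (map bk [0..<g])" for g
  have ys_Suc: "ys (Suc g) = ys g @ bk g" for g by (simp add: ys_def)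
  have len_n: "length (ys n) = n" using mset_eq_length[OF perm] by (simp add: ys_def)
  have len: "length (ys g) \<le> n" if "g \<le> n" for g
    using that
  proof (induction rule: inc_induct)
    case (step m)
    then show ?case by (simp add: ys_Suc)
  qed (simp add: len_n)
  define I where "I = (\<lambda>g (R, M). consts R \<and> R 19 = n ^ j \<and> R 20 = g \<and> R 26 = n + length (ys g) \<and>
    buckets_inv bk M \<and> (\<forall>i<length (ys g). M (n + i) = ys g ! i) \<and>
    (\<forall>g'<n. M (2 * n + g') = (if g' < g then 0 else length (bk g'))))"
  have time: "(\<Sum>g<m. 5 * length (bk g) + 8 + 1) = 5 * length (ys m) + 9 * m" for m
    by (induction m) (simp_all add: ys_Suc, simp add: ys_def)
  show ?thesis
  proof (rule wp_While[where I = I and N = n and f = "\<lambda>g. 5 * length (bk g) + 8"])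
    fix g s assume g: "g < n" and I: "I g s"
    obtain R M where s: "s = (R, M)" by fastforce
    show "cmp_holds Lt (fst s 20) (fst s 0)" using I g unfolding s I_def consts_def by simp
    define c where "c = length (bk g)"
    define a where "a = (g + 5) * n"
    \<comment> \<open>The output cannot leave row 1, since the buckets up to \<open>g\<close> hold
      at most \<open>n\<close> positions.\<close>
    have lc: "length (ys g) + c \<le> n" using len[of "Suc g"] g by (simp add: ys_Suc c_def)
    have a: "5 * n \<le> a" "a + n \<le> Db"
      using row_bounds[OF g, of "n - 1"] n_ge by (simp_all add: a_def)
    define J where "J = (\<lambda>i (R, M). consts R \<and> R 19 = n ^ j \<and> R 20 = g \<and> R 23 = 2 * n + g \<and>
      R 25 = a + i \<and> R 26 = n + length (ys g) + i \<and> R 27 = a + c \<and> buckets_inv bk M \<and>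
      (\<forall>i'<length (ys g) + i. M (n + i') = ys (Suc g) ! i') \<and>
      (\<forall>g'<n. M (2 * n + g') = (if g' < g then 0 else length (bk g'))))"
    have R: "consts R" "R 19 = n ^ j" "R 20 = g" "R 26 = n + length (ys g)" "M (2 * n + g) = c"
      using I g by (auto simp: s I_def c_def)
    have J0: "J 0 (R(23 := 2 * n + g, 24 := c, 25 := a, 27 := a + c), M)"
      using I by (auto simp: s I_def J_def consts_def ys_Suc nth_append)
    have inner: "wp bw (While Lt 25 27 (seqs [Instr (Load 21 25), Instr (Store 26 21), Instr (Op Add 25 25 3),
        Instr (Op Add 26 26 3)])) (5 * c + 1) (J c) s1" if "J 0 s1" for s1
    proof (rule wp_While[where I = J and N = c and f = "\<lambda>_. 4"])
      fix i s1 assume i: "i < c" and J: "J i s1"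
      obtain R M where s1: "s1 = (R, M)" by fastforce
      show "cmp_holds Lt (fst s1 25) (fst s1 27)" using J i by (simp add: J_def s1)
      define M' where "M' = M(n + length (ys g) + i := bk g ! i)"
      have ld: "M (a + i) = bk g ! i"
        using J i g by (auto simp: J_def s1 buckets_inv_def a_def c_def)
      have bM: "buckets_inv bk M" using J by (simp add: J_def s1)
      have "buckets_inv bk M'"
        unfolding buckets_inv_def
      proof (intro conjI allI impI)
        show "M' i' = T ! i'" if "i' < n" for i'
          using bM that by (auto simp: M'_def buckets_inv_def)
        show "frame_zero M'"
          using bM lc i bounds by (auto simp: M'_def buckets_inv_def frame_zero_def)
        fix g' i' assume g': "g' < n" and i': "i' < length (bk g')"
        have "5 * n \<le> (g' + 5) * n" by simp
        then have "(g' + 5) * n + i' \<noteq> n + length (ys g) + i" using lc i n_ge by linarith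
        then show "M' ((g' + 5) * n + i') = bk g' ! i'"
          using bM g' i' by (auto simp: M'_def buckets_inv_def)
      qed
      moreover have "\<forall>i'<length (ys g) + Suc i. M' (n + i') = ys (Suc g) ! i'"
        using J i by (auto simp: J_def s1 M'_def ys_Suc nth_append c_def less_Suc_eq)
      moreover have "\<forall>g'<n. M' (2 * n + g') = (if g' < g then 0 else length (bk g'))"
        using J lc i by (auto simp: J_def s1 M'_def)
      ultimately have "J (Suc i) (R(21 := bk g ! i, 25 := a + Suc i, 26 := n + length (ys g) + Suc i), M')"
        using J by (auto simp: J_def s1 consts_def)
      then show "wp bw (seqs [Instr (Load 21 25), Instr (Store 26 21), Instr (Op Add 25 25 3),
          Instr (Op Add 26 26 3)]) 4 (J (Suc i)) s1"
        using J i lc a bounds unfolding s1 by (simp add: wp_simps J_def ld M'_def consts_def)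
    qed (use that in \<open>auto simp: J_def\<close>)
    have last: "wp bw (seqs [Instr (Store 23 4), Instr (Op Add 20 20 3)]) 2 (I (Suc g)) s1"
      if J: "J c s1" for s1
    proof -
      obtain R M where s1: "s1 = (R, M)" by fastforce
      have bM: "buckets_inv bk M" using J by (simp add: J_def s1)
      define M' where "M' = M(2 * n + g := 0)"
      have "buckets_inv bk M'"
        unfolding buckets_inv_def
      proof (intro conjI allI impI)
        show "M' i' = T ! i'" if "i' < n" for i'
          using bM that by (auto simp: M'_def buckets_inv_def)
        show "frame_zero M'"
          using bM g bounds by (auto simp: M'_def buckets_inv_def frame_zero_def)
        fix g' i' assume g': "g' < n" and i': "i' < length (bk g')"
        have "5 * n \<le> (g' + 5) * n" by simp
        then have "(g' + 5) * n + i' \<noteq> 2 * n + g" using g by linarith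
        then show "M' ((g' + 5) * n + i') = bk g' ! i'"
          using bM g' i' by (auto simp: M'_def buckets_inv_def)
      qed
      then have "I (Suc g) (R(20 := Suc g), M')"
        using J lc by (auto simp: I_def J_def s1 M'_def consts_def ys_Suc c_def)
      then show ?thesis
        using J g bounds unfolding s1 by (simp add: wp_simps J_def consts_def M'_def)
    qed
    have "wp bw (Seq (While Lt 25 27 (seqs [Instr (Load 21 25), Instr (Store 26 21), Instr (Op Add 25 25 3),
        Instr (Op Add 26 26 3)])) (seqs [Instr (Store 23 4), Instr (Op Add 20 20 3)])) (3 + 5 * c)
        (I (Suc g)) (R(23 := 2 * n + g, 24 := c, 25 := a, 27 := a + c), M)"
      by (rule wp_SeqI[OF inner[OF J0] last]) simp_all
    then show "wp bw collect_body (5 * length (bk g) + 8) (I (Suc g)) s"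
      using R a lc bounds g unfolding s collect_body_def
      by (simp add: wp_simps consts_def c_def[symmetric] a_def[symmetric])
  next
    fix s assume "I n s"
    then show "\<not> cmp_holds Lt (fst s 20) (fst s 0)" unfolding I_def consts_def by (cases s) auto
  next
    show "I 0 s" using s unfolding I_def by (cases s) (auto simp: ys_def)
  next
    fix s assume "I n s"
    then show "case s of (R, M) \<Rightarrow> consts R \<and> R 19 = n ^ j \<and> perm_inv (concat (map bk [0..<n])) M"
      using perm len_n unfolding I_def perm_inv_def ys_def
      by (cases s) (simp add: buckets_inv_def frame_zero_def)
  next
    show "(\<Sum>g<n. 5 * length (bk g) + 8 + 1) + 1 \<le> 14 * n + 1"
      unfolding time using len_n by simp
  qed
qed

lemma wp_pass:
  assumes j: "j < k" and s: "consts (fst s)" "fst s 19 = n ^ j" "perm_inv xs (snd s)"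
  shows "wp bw pass_prog (30 * n) (\<lambda>(R, M). consts R \<and> R 19 = n ^ Suc j \<and>
    perm_inv (bucket_sort (digit j) n xs) M) s"
proof -
  have xs: "mset xs = mset [0..<n]" using s by (simp add: perm_inv_def)
  have n0: "0 < n" using n_ge by simp
  have ys: "bucket_sort (digit j) n xs = concat (map (bucket j xs) [0..<n])"
    by (simp add: bucket_sort_def bucket_def[abs_def])
  have perm: "mset (concat (map (bucket j xs) [0..<n])) = mset [0..<n]"
    unfolding ys[symmetric] xs[symmetric] using n0 by (intro mset_bucket_sort) (simp add: digit_def)
  have nj: "n ^ j * n < 2 ^ bw"
  proof -
    have "n ^ j * n ^ 1 \<le> n ^ j * n ^ 5" using n0 by (intro mult_left_mono power_increasing) auto
    then show ?thesis using pow_less_word[of j] j unfolding power_one_right by linarith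
  qed
  obtain R M where sRM: "s = (R, M)" by fastforce
  define I1 where "I1 = (\<lambda>(R, M). consts R \<and> R 19 = n ^ j \<and> R 20 = 0 \<and> perm_inv xs M)"
  define I2 where "I2 = (\<lambda>(R, M). consts R \<and> R 19 = n ^ j \<and> buckets_inv (bucket j xs) M \<and>
      (\<forall>g<n. M (2 * n + g) = length (bucket j xs g)))"
  define I3 where "I3 = (\<lambda>(R, M). consts R \<and> R 19 = n ^ j \<and> perm_inv (concat (map (bucket j xs) [0..<n])) M)"
  have 1: "wp bw (While Lt 20 0 distribute_body) (15 * n + 1) I2 s'" if "I1 s'" for s'
    unfolding I2_def by (rule wp_distribute[OF xs]) (use that in \<open>auto simp: I1_def\<close>)
  have 2: "wp bw (seqs [Instr (Const 20 0), Instr (Op Add 26 0 4), While Lt 20 0 collect_body,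
      Instr (Op Mul 19 19 0)]) (14 * n + 4) (\<lambda>(R, M). consts R \<and> R 19 = n ^ Suc j \<and>
      perm_inv (concat (map (bucket j xs) [0..<n])) M) s'" if "I2 s'" for s'
  proof -
    obtain R M where s': "s' = (R, M)" by fastforce
    have "wp bw (While Lt 20 0 collect_body) (14 * n + 1) I3 (R(20 := 0, 26 := n), M)"
      unfolding I3_def by (rule wp_collect[OF perm]) (use that in \<open>auto simp: I2_def s' consts_def\<close>)
    moreover have "wp bw (Seq (Instr (Op Mul 19 19 0)) Skip) 1 (\<lambda>(R, M). consts R \<and> R 19 = n ^ Suc j \<and>
      perm_inv (concat (map (bucket j xs) [0..<n])) M) s''" if "I3 s''" for s''
      using that nj by (cases s'') (simp add: wp_simps I3_def consts_def mult.commute)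
    ultimately have "wp bw (Seq (While Lt 20 0 collect_body) (Seq (Instr (Op Mul 19 19 0)) Skip)) (14 * n + 2)
      (\<lambda>(R, M). consts R \<and> R 19 = n ^ Suc j \<and> perm_inv (concat (map (bucket j xs) [0..<n])) M)
      (R(20 := 0, 26 := n), M)"
      by (rule wp_SeqI) simp_all
    then show ?thesis using that bounds unfolding s' by (simp add: wp_simps I2_def consts_def)
  qed
  have "wp bw (Seq (While Lt 20 0 distribute_body) (seqs [Instr (Const 20 0), Instr (Op Add 26 0 4),
      While Lt 20 0 collect_body, Instr (Op Mul 19 19 0)])) (30 * n - 1) (\<lambda>(R, M). consts R \<and> R 19 = n ^ Suc j \<and>
      perm_inv (concat (map (bucket j xs) [0..<n])) M) (R(20 := 0), M)"
    by (rule wp_SeqI[OF 1 2]) (use s n_ge in \<open>auto simp: I1_def sRM consts_def\<close>)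
  then show ?thesis
    unfolding ys sRM pass_prog_def seqs.simps(2)[of "Instr (Const 20 0)"] seqs.simps(2)[of "While Lt 20 0 distribute_body"]
    using n_ge by (subst wp_Const) simp_all
qed

text \<open>Letters below \<open>n ^ k\<close> have \<open>k\<close> digits in base
  \<open>n\<close>. As \<open>k\<close> is a constant, the passes are written out in the program by
  \<open>replicate\<close> and need no loop.\<close>

lemma wp_sort:
  assumes "j + m \<le> k" "consts (fst s)" "fst s 19 = n ^ j" "perm_inv (radix_sort ((!) T) n j [0..<n]) (snd s)"
  shows "wp bw (seqs (replicate m pass_prog)) (30 * n * m)
    (\<lambda>(R, M). consts R \<and> perm_inv (radix_sort ((!) T) n (j + m) [0..<n]) M) s"
  using assms
proof (induction m arbitrary: j s)
  case (Suc m)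
  have d: "bucket_sort (digit j) n (radix_sort ((!) T) n j [0..<n]) = radix_sort ((!) T) n (Suc j) [0..<n]"
    by (simp add: digit_def[abs_def])
  have IH: "wp bw (seqs (replicate m pass_prog)) (30 * n * m)
    (\<lambda>(R, M). consts R \<and> perm_inv (radix_sort ((!) T) n (Suc j + m) [0..<n]) M) s'"
    if "(\<lambda>(R, M). consts R \<and> R 19 = n ^ Suc j \<and> perm_inv (radix_sort ((!) T) n (Suc j) [0..<n]) M) s'" for s'
    by (rule Suc.IH) (use Suc.prems that in auto)
  have "wp bw (Seq pass_prog (seqs (replicate m pass_prog))) (30 * n * Suc m)
    (\<lambda>(R, M). consts R \<and> perm_inv (radix_sort ((!) T) n (Suc j + m) [0..<n]) M) s"
    by (rule wp_SeqI[OF wp_pass[of j, unfolded d] IH]) (use Suc.prems in \<open>auto simp: d\<close>)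
  then show ?case by simp
qed (auto simp: wp_Skip)

end

section \<open>Ranks within windows\<close>

context min_suffix_params begin

text \<open>Window \<open>w\<close> consists of the blocks \<open>w - 1\<close> and
  \<open>w\<close>. The shift by one gives each position \<open>p\<close> the windows
  \<open>p div \<tau>\<close> and \<open>Suc (p div \<tau>)\<close>, and a query from
  \<open>l\<close> uses \<open>Suc (l div \<tau>)\<close>.\<close>

definition "window w = {p. p < n \<and> (w = p div \<tau> \<or> w = Suc (p div \<tau>))}"
definition "rank w p = card {y \<in> (!) T ` window w. y \<le> T ! p}"
text \<open>Slots number the digits of all cells consecutively, \<open>2 * \<tau>\<close> for each
  window. Within a window they are counted from its right end \<open>Suc w * \<tau> - 1\<close>,
  which gives earlier letters the higher digits.\<close>

definition "slot w p = 2 * \<tau> * w + (Suc w * \<tau> - 1 - p)"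
definition "pairs = {(w, p). p \<in> window w}"
text \<open>\<open>S\<close> is the set of pairs treated so far; the same formula describes a cell
  during the scan and, for \<open>pairs\<close>, in the finished structure.\<close>

definition "cell S q = (\<Sum>(w, p) | (w, p) \<in> S \<and> slot w p div slots = q.
  rank w p * 2 ^ (b * (slot w p mod slots)))"

lemma window_le:
  assumes "p \<in> window w" shows "p < Suc w * \<tau>" "w * \<tau> \<le> p + \<tau>"
proof -
  have "0 < \<tau>" using \<tau>_ge by simp
  have *: "p div \<tau> * \<tau> \<le> p" "p < p div \<tau> * \<tau> + \<tau>"
    using dividend_less_div_times[OF \<open>0 < \<tau>\<close>, of p] by simp_all
  have "w = p div \<tau> \<or> w = Suc (p div \<tau>)" using assms by (simp add: window_def)
  then show "p < Suc w * \<tau>" "w * \<tau> \<le> p + \<tau>"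
    using *(2) trans_le_add1[OF *(1), of \<tau>] by auto
qed

lemma finite_window: "finite (window w)"
  unfolding window_def by simp

lemma rank_le: "rank w p \<le> 2 * \<tau>"
proof -
  have "window w \<subseteq> {w * \<tau> - \<tau>..<w * \<tau> + \<tau>}"
    using window_le by fastforce
  then have "card (window w) \<le> card {w * \<tau> - \<tau>..<w * \<tau> + \<tau>}" by (intro card_mono) auto
  then have "card (window w) \<le> 2 * \<tau>" by simp
  moreover have "rank w p \<le> card ((!) T ` window w)"
    unfolding rank_def using finite_window by (intro card_mono) auto
  ultimately show ?thesis using card_image_le[OF finite_window, of "(!) T" w] by linarith
qed

lemma rank_less: "rank w p < 2 ^ b"
  using rank_le[of w p] b_gt by linarith

lemma rank_strict_mono:
  assumes "p' \<in> window w" "T ! p < T ! p'" shows "rank w p < rank w p'"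
  unfolding rank_def
proof (rule psubset_card_mono)
  have "T ! p' \<in> {y \<in> (!) T ` window w. y \<le> T ! p'}" "T ! p' \<notin> {y \<in> (!) T ` window w. y \<le> T ! p}"
    using assms by auto
  then show "{y \<in> (!) T ` window w. y \<le> T ! p} \<subset> {y \<in> (!) T ` window w. y \<le> T ! p'}"
    using assms(2) by fastforce
qed (use finite_window in auto)

lemma rank_pos: assumes "p \<in> window w" shows "0 < rank w p"
  unfolding rank_def using assms finite_window[of w] by (auto simp: card_gt_0_iff)

lemma slot_less:
  assumes "p \<in> window w" shows "Suc w * \<tau> - 1 - p < 2 * \<tau>" "slot w p div (2 * \<tau>) = w"
proof -
  show 1: "Suc w * \<tau> - 1 - p < 2 * \<tau>" using window_le[OF assms] \<tau>_ge by simp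
  then show "slot w p div (2 * \<tau>) = w" unfolding slot_def by simp
qed

lemma slot_inj:
  assumes "p \<in> window w" "p' \<in> window w'" "slot w p = slot w' p'"
  shows "w = w' \<and> p = p'"
proof -
  have w: "w = w'" using slot_less(2)[OF assms(1)] slot_less(2)[OF assms(2)] assms(3) by simp
  then have "Suc w * \<tau> - 1 - p = Suc w * \<tau> - 1 - p'" using assms(3) by (simp add: slot_def)
  then show ?thesis using window_le(1)[OF assms(1)] window_le(1)[OF assms(2)] w by simp
qed

lemma finite_pairs: "finite pairs"
proof (rule finite_subset)
  show "pairs \<subseteq> {..n} \<times> {..<n}"
  proof (rule subrelI)
    fix w p assume "(w, p) \<in> pairs"
    then have "p < n" "w \<le> Suc (p div \<tau>)" by (auto simp: pairs_def window_def)
    moreover from this(1) have "p div \<tau> < n" by (rule le_less_trans[OF div_le_dividend])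
    ultimately show "(w, p) \<in> {..n} \<times> {..<n}" by simp
  qed
qed simp

text \<open>The sum has at most one term, as \<open>slot_inj\<close> shows; it is the digit in slot
  \<open>s\<close>, with default \<open>0\<close> for a slot that is empty.\<close>

definition "slot_digit S s = (\<Sum>(w, p) | (w, p) \<in> S \<and> slot w p = s. rank w p)"

lemma slot_digit_eq:
  assumes "S \<subseteq> pairs" "(w, p) \<in> S" shows "slot_digit S (slot w p) = rank w p"
proof -
  have "{(w', p'). (w', p') \<in> S \<and> slot w' p' = slot w p} = {(w, p)}"
    using assms slot_inj by (fastforce simp: pairs_def)
  then show ?thesis unfolding slot_digit_def by simp
qed

lemma slot_digit_less:
  assumes "S \<subseteq> pairs" shows "slot_digit S s < 2 ^ b"
proof (cases "\<exists>(w, p)\<in>S. slot w p = s")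
  case True
  then show ?thesis using slot_digit_eq[OF assms] rank_less by auto
next
  case False
  then have *: "{(w', p'). (w', p') \<in> S \<and> slot w' p' = s} = {}" by auto
  show ?thesis unfolding slot_digit_def * by simp
qed

text \<open>Grouping the pairs of a cell by their slots turns the sum over pairs into a numeral in
  base \<open>2 ^ b\<close>. Additions to a cell therefore never carry from one slot into the
  next.\<close>

lemma cell_eq:
  assumes "S \<subseteq> pairs"
  shows "cell S q = (\<Sum>i<slots. slot_digit S (q * slots + i) * (2 ^ b) ^ i)"
proof -
  have "finite S" using assms finite_pairs by (rule finite_subset)
  let ?X = "{(w, p). (w, p) \<in> S \<and> slot w p div slots = q}"
  have "cell S q = (\<Sum>x\<in>?X. rank (fst x) (snd x) * 2 ^ (b * (slot (fst x) (snd x) mod slots)))"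
    unfolding cell_def by (simp add: case_prod_beta)
  also have "\<dots> = (\<Sum>i<slots. \<Sum>x | x \<in> ?X \<and> slot (fst x) (snd x) mod slots = i.
      rank (fst x) (snd x) * 2 ^ (b * (slot (fst x) (snd x) mod slots)))"
  proof (rule sum.group[symmetric])
    show "finite ?X" by (rule finite_subset[OF _ \<open>finite S\<close>]) auto
  qed (use slots_pos in auto)
  also have "\<dots> = (\<Sum>i<slots. slot_digit S (q * slots + i) * (2 ^ b) ^ i)"
  proof (rule sum.cong[OF refl])
    fix i assume i: "i \<in> {..<slots}"
    have eq: "slot w p div slots = q \<and> slot w p mod slots = i \<longleftrightarrow> slot w p = q * slots + i" for w p
      using i div_mult_mod_eq[of "slot w p" slots] by auto
    have "{x. x \<in> ?X \<and> slot (fst x) (snd x) mod slots = i}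
        = {(w, p). (w, p) \<in> S \<and> (slot w p div slots = q \<and> slot w p mod slots = i)}" by auto
    also have "\<dots> = {(w, p). (w, p) \<in> S \<and> slot w p = q * slots + i}" unfolding eq ..
    finally have "{x. x \<in> ?X \<and> slot (fst x) (snd x) mod slots = i} = {(w, p). (w, p) \<in> S \<and> slot w p = q * slots + i}" .
    moreover have "(\<Sum>x | x \<in> ?X \<and> slot (fst x) (snd x) mod slots = i.
        rank (fst x) (snd x) * 2 ^ (b * (slot (fst x) (snd x) mod slots)))
        = (\<Sum>x | x \<in> ?X \<and> slot (fst x) (snd x) mod slots = i. rank (fst x) (snd x) * (2 ^ b) ^ i)"
      by (intro sum.cong) (auto simp: power_mult)
    ultimately show "(\<Sum>x | x \<in> ?X \<and> slot (fst x) (snd x) mod slots = i.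
        rank (fst x) (snd x) * 2 ^ (b * (slot (fst x) (snd x) mod slots)))
        = slot_digit S (q * slots + i) * (2 ^ b) ^ i"
      unfolding slot_digit_def sum_distrib_right by (simp add: case_prod_beta)
  qed
  finally show ?thesis .
qed

lemma cell_less: "S \<subseteq> pairs \<Longrightarrow> cell S q < 2 ^ (b * slots)"
  unfolding cell_eq power_mult by (intro sum_digits_less slot_digit_less)

lemma cell_insert:
  assumes "finite S" "(w, p) \<notin> S"
  shows "cell (insert (w, p) S) q = cell S q +
    (if slot w p div slots = q then rank w p * 2 ^ (b * (slot w p mod slots)) else 0)"
proof -
  have *: "{(w', p'). (w', p') \<in> insert (w, p) S \<and> slot w' p' div slots = q} =
    (if slot w p div slots = q then insert (w, p) else id) {(w', p'). (w', p') \<in> S \<and> slot w' p' div slots = q}"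
    by auto
  have "finite {(w', p'). (w', p') \<in> S \<and> slot w' p' div slots = q}"
    by (rule finite_subset[OF _ assms(1)]) auto
  then show ?thesis using assms(2) unfolding cell_def * by simp
qed

section \<open>Ranks as counts along the scan of the sorted positions\<close>

definition "scan_pair xs i = (xs ! (i div 2) div \<tau> + i mod 2, xs ! (i div 2))"
definition "scanned xs i = scan_pair xs ` {..<i}"
definition "seen S w = (!) T ` {p. (w, p) \<in> S}"

lemma scan_pair_window:
  assumes "mset xs = mset [0..<n]" "i < 2 * n" "scan_pair xs i = (w, p)"
  shows "p \<in> window w" "p < n" "w < n"
proof -
  have "length xs = n" using mset_eq_length[OF assms(1)] by simp
  then have "p \<in> set xs" using assms(2,3) by (auto simp: scan_pair_def)
  then show p: "p < n" using mset_eq_setD[OF assms(1)] by auto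
  show "p \<in> window w" using assms(3) p by (auto simp: scan_pair_def window_def)
  then have "w \<le> Suc (p div \<tau>)" by (auto simp: window_def)
  moreover have "p div \<tau> \<le> p div 2" using \<tau>_ge by (rule div_le_mono2[rotated]) simp
  ultimately show "w < n" using p n_ge by simp
qed

text \<open>In round \<open>i\<close>, \<open>i div 2\<close> selects a place in the sorted list and
  the parity of \<open>i\<close> one of the two windows of the position found there. So each slot in
  use receives its rank in exactly one of the \<open>2 * n\<close> rounds.\<close>

lemma scan_pair_inj:
  assumes "mset xs = mset [0..<n]"
  shows "inj_on (scan_pair xs) {..<2 * n}" "scan_pair xs ` {..<2 * n} = pairs"
proof -
  have len: "length xs = n" using mset_eq_length[OF assms] by simp
  have set: "set xs = {..<n}" unfolding mset_eq_setD[OF assms] by (simp add: lessThan_atLeast0)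
  have dist: "distinct xs"
    using mset_eq_imp_distinct_iff[OF assms] by simp
  show "inj_on (scan_pair xs) {..<2 * n}"
  proof (rule inj_onI)
    fix i j assume ij: "i \<in> {..<2 * n}" "j \<in> {..<2 * n}" "scan_pair xs i = scan_pair xs j"
    then have "i div 2 = j div 2"
      using dist len nth_eq_iff_index_eq[OF dist, of "i div 2" "j div 2"] by (auto simp: scan_pair_def)
    moreover from this ij have "i mod 2 = j mod 2" by (simp add: scan_pair_def)
    ultimately show "i = j" by (metis div_mult_mod_eq)
  qed
  show "scan_pair xs ` {..<2 * n} = pairs"
  proof
    show "scan_pair xs ` {..<2 * n} \<subseteq> pairs"
      using scan_pair_window[OF assms] by (force simp: pairs_def)
    show "pairs \<subseteq> scan_pair xs ` {..<2 * n}"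
    proof
      fix x assume "x \<in> pairs"
      then obtain w p where x: "x = (w, p)" "p < n" "w = p div \<tau> \<or> w = Suc (p div \<tau>)"
        by (auto simp: pairs_def window_def)
      have "p \<in> set xs" using set x(2) by simp
      then obtain j where j: "j < n" "xs ! j = p" unfolding in_set_conv_nth len by blast
      show "x \<in> scan_pair xs ` {..<2 * n}"
      proof (cases "w = p div \<tau>")
        case True
        then show ?thesis using j x by (intro image_eqI[of _ _ "2 * j"]) (auto simp: scan_pair_def)
      next
        case False
        then show ?thesis using j x by (intro image_eqI[of _ _ "2 * j + 1"]) (auto simp: scan_pair_def)
      qed
    qed
  qed
qed

lemma scanned_Suc: "scanned xs (Suc i) = insert (scan_pair xs i) (scanned xs i)"
  by (simp add: scanned_def lessThan_Suc)

lemma scanned_subset: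
  assumes "mset xs = mset [0..<n]" "i \<le> 2 * n" shows "scanned xs i \<subseteq> pairs"
  unfolding scanned_def scan_pair_inj(2)[OF assms(1), symmetric] using assms(2) by (intro image_mono) auto

text \<open>Letters arrive in ascending order. If a letter of the window is at most
  \<open>T ! p\<close> but its position comes after round \<open>i\<close>, it is also at least
  \<open>T ! p\<close>, hence equal to it and already met. So after the round the letters seen in
  \<open>w\<close> are exactly those that \<open>rank w p\<close> counts.\<close>

lemma scan_step:
  assumes xs: "mset xs = mset [0..<n]" and sorted: "sorted (map ((!) T) xs)"
    and i: "i < 2 * n" and wp: "scan_pair xs i = (w, p)"
  shows "(w, p) \<notin> scanned xs i"
    "seen (scanned xs (Suc i)) w = insert (T ! p) (seen (scanned xs i) w)"
    "w' \<noteq> w \<Longrightarrow> seen (scanned xs (Suc i)) w' = seen (scanned xs i) w'"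
    "y \<in> seen (scanned xs i) w \<Longrightarrow> y \<le> T ! p"
    "rank w p = card (seen (scanned xs (Suc i)) w)"
proof -
  have len: "length xs = n" using mset_eq_length[OF xs] by simp
  show "(w, p) \<notin> scanned xs i"
  proof
    assume "(w, p) \<in> scanned xs i"
    then obtain j where "j < i" "scan_pair xs j = scan_pair xs i" by (auto simp: scanned_def wp)
    then show False using inj_onD[OF scan_pair_inj(1)[OF xs], of j i] i by auto
  qed
  show seen: "seen (scanned xs (Suc i)) w = insert (T ! p) (seen (scanned xs i) w)"
    "w' \<noteq> w \<Longrightarrow> seen (scanned xs (Suc i)) w' = seen (scanned xs i) w'"
    by (auto simp: seen_def scanned_Suc wp)
  have mono: "T ! p1 \<le> T ! p2"
    if "scan_pair xs j1 = (w1, p1)" "scan_pair xs j2 = (w2, p2)" "j1 \<le> j2" "j2 < 2 * n" for j1 j2 w1 p1 w2 p2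
  proof -
    have "map ((!) T) xs ! (j1 div 2) \<le> map ((!) T) xs ! (j2 div 2)"
      using that(3,4) len by (intro sorted_nth_mono[OF sorted] div_le_mono) auto
    moreover have "p1 = xs ! (j1 div 2)" "p2 = xs ! (j2 div 2)"
      using that(1,2) by (simp_all add: scan_pair_def)
    moreover have "j1 div 2 < length xs" "j2 div 2 < length xs" using that(3,4) len by linarith+
    ultimately show ?thesis by simp
  qed
  show le: "y \<le> T ! p" if "y \<in> seen (scanned xs i) w" for y
  proof -
    from that obtain p' j where "y = T ! p'" "j < i" "scan_pair xs j = (w, p')"
      by (auto simp: seen_def scanned_def)
    then show ?thesis using mono[OF _ wp] i by auto
  qed
  have "{y \<in> (!) T ` window w. y \<le> T ! p} = seen (scanned xs (Suc i)) w"
  proof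
    show "seen (scanned xs (Suc i)) w \<subseteq> {y \<in> (!) T ` window w. y \<le> T ! p}"
    proof
      fix y assume y: "y \<in> seen (scanned xs (Suc i)) w"
      then have "y \<in> (!) T ` window w"
        using scanned_subset[OF xs, of "Suc i"] i by (auto simp: seen_def pairs_def)
      moreover have "y \<le> T ! p" using y le unfolding seen by auto
      ultimately show "y \<in> {y \<in> (!) T ` window w. y \<le> T ! p}" by simp
    qed
    show "{y \<in> (!) T ` window w. y \<le> T ! p} \<subseteq> seen (scanned xs (Suc i)) w"
    proof
      fix y assume "y \<in> {y \<in> (!) T ` window w. y \<le> T ! p}"
      then obtain p' where p': "y = T ! p'" "p' \<in> window w" "y \<le> T ! p" by auto
      then have "(w, p') \<in> scan_pair xs ` {..<2 * n}" unfolding scan_pair_inj(2)[OF xs] by (simp add: pairs_def)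
      then obtain j where j: "j < 2 * n" "scan_pair xs j = (w, p')" by auto
      show "y \<in> seen (scanned xs (Suc i)) w"
      proof (cases "j \<le> i")
        case True
        then have "(w, p') \<in> scanned xs (Suc i)" using j unfolding scanned_def by (intro image_eqI[of _ _ j]) auto
        then show ?thesis using p' by (auto simp: seen_def)
      next
        case False
        then have "T ! p \<le> T ! p'" using mono[OF wp j(2)] j by simp
        then show ?thesis using p' unfolding seen by simp
      qed
    qed
  qed
  then show "rank w p = card (seen (scanned xs (Suc i)) w)" by (simp add: rank_def)
qed

end

text \<open>Register 23 is the window, 24 and 26 address its entries in rows 3 and 4, 27 is the
  count that becomes the rank, 28 first the slot and then the bit offset in the cell, 29 finally the
  address of the cell.\<close>

definition "scan_body = seqs [
  Instr (Op Div 21 20 5), Instr (Op Add 21 0 21), Instr (Load 21 21), Instr (Load 22 21),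
  Instr (Op Add 22 22 3), Instr (Op Div 23 21 2), Instr (Op Mod 24 20 5), Instr (Op Add 23 23 24),
  Instr (Op Add 24 13 23), Instr (Load 25 24), Instr (Op Add 26 14 23), Instr (Load 27 26),
  If Neq 25 22 (seqs [Instr (Store 24 22), Instr (Op Add 27 27 3), Instr (Store 26 27)]) Skip,
  Instr (Op Mul 28 6 23), Instr (Op Add 29 23 3), Instr (Op Mul 29 29 2), Instr (Op Sub 29 29 3),
  Instr (Op Sub 29 29 21), Instr (Op Add 28 28 29), Instr (Op Div 29 28 11), Instr (Op Add 29 17 29),
  Instr (Op Mod 28 28 11), Instr (Op Mul 28 7 28), Instr (Op Shl 27 27 28), Instr (Load 30 29),
  Instr (Op Add 30 30 27), Instr (Store 29 30), Instr (Op Add 20 20 3)]"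

context min_suffix_params begin

definition "last_seen A = (if A = {} then 0 else Suc (Max (A :: nat set)))"

text \<open>In ascending order the last letter met is the maximum, so one comparison with it tells
  whether \<open>x\<close> is new, and the number of distinct letters can be maintained in constant
  time. The shift by one distinguishes the letter \<open>0\<close> from an untouched memory
  cell.\<close>

lemma last_seen_insert:
  assumes "finite A" "\<And>y. y \<in> A \<Longrightarrow> y \<le> x"
  shows "last_seen (insert x A) = Suc x" "last_seen A = Suc x \<longleftrightarrow> x \<in> A"
    "card (insert x A) = (if last_seen A = Suc x then card A else Suc (card A))"
proof -
  have "Max (insert x A) = x" using assms by (intro Max_eqI) auto
  then show "last_seen (insert x A) = Suc x" by (simp add: last_seen_def)
  have "Max A = x \<longleftrightarrow> x \<in> A" if "A \<noteq> {}"
  proof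
    show "Max A = x \<Longrightarrow> x \<in> A" using Max_in[OF assms(1) that] by auto
    show "x \<in> A \<Longrightarrow> Max A = x" using assms by (intro Max_eqI) auto
  qed
  then show *: "last_seen A = Suc x \<longleftrightarrow> x \<in> A" by (auto simp: last_seen_def)
  show "card (insert x A) = (if last_seen A = Suc x then card A else Suc (card A))"
    using assms(1) * by (simp add: card_insert_if)
qed

definition "cells_at M = (\<lambda>q. M (Db + 4 + full + q) :: nat)"

lemma wp_scan:
  assumes xs: "mset xs = mset [0..<n]" and sorted: "sorted (map ((!) T) xs)"
    and s: "consts (fst s)" "fst s 20 = 0" "perm_inv xs (snd s)"
  shows "wp bw (While Lt 20 12 scan_body) (66 * n + 1)
    (\<lambda>(R, M). consts R \<and> cells_at M = cell pairs) s"
proof -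
  define I where "I = (\<lambda>i (R, M). consts R \<and> R 20 = i \<and>
    (\<forall>i<n. M i = T ! i) \<and> (\<forall>i<n. M (n + i) = xs ! i) \<and>
    (\<forall>w<n. M (3 * n + w) = last_seen (seen (scanned xs i) w)) \<and>
    (\<forall>w<n. M (4 * n + w) = card (seen (scanned xs i) w)) \<and>
    cells_at M = cell (scanned xs i))"
  have empty: "seen {} w = {}" "cell {} q = 0" for w q
    by (auto simp: seen_def cell_def)
  show ?thesis
  proof (rule wp_While[where I = I and N = "2 * n" and f = "\<lambda>_. 32"])
    fix i s assume i: "i < 2 * n" and I: "I i s"
    obtain R M where s: "s = (R, M)" by fastforce
    show "cmp_holds Lt (fst s 20) (fst s 12)" using I i unfolding s I_def consts_def by simp
    obtain w p where wp: "scan_pair xs i = (w, p)" by fastforce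
    note window = scan_pair_window[OF xs i wp]
    note step = scan_step[OF xs sorted i wp]
    note sub = scanned_subset[OF xs, of i] scanned_subset[OF xs, of "Suc i"]
    define S where "S = scanned xs i"
    define S' where "S' = scanned xs (Suc i)"
    have S: "S \<subseteq> pairs" "S' \<subseteq> pairs" "S' = insert (w, p) S" "finite S"
      using sub i finite_subset[OF _ finite_pairs] by (auto simp: S_def S'_def scanned_Suc wp)
    have fin: "finite (seen S w)" unfolding seen_def
      by (rule finite_imageI, rule finite_subset[OF _ finite_imageI[OF S(4), of snd]]) force
    have R: "consts R" "R 20 = i" using I by (auto simp: s I_def)
    define v where "v = Suc (T ! p)"
    define la where "la = last_seen (seen S w)"
    define rk where "rk = card (seen S w)"
    have "xs ! (i div 2) = p" "p div \<tau> + i mod 2 = w" using wp by (auto simp: scan_pair_def)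
    moreover have "i div 2 < n" using i by simp
    ultimately have M: "M (n + i div 2) = p" "M p = T ! p" "M (3 * n + w) = la" "M (4 * n + w) = rk"
        "p div \<tau> + i mod 2 = w" "cells_at M = cell S"
      and Mxs: "\<forall>i<n. M (n + i) = xs ! i" "\<forall>i<n. M i = T ! i"
        "\<forall>w<n. M (3 * n + w) = last_seen (seen S w)" "\<forall>w<n. M (4 * n + w) = card (seen S w)"
      using I window by (auto simp: s I_def la_def rk_def S_def)
    note ls = last_seen_insert[OF fin step(4)[folded S_def]]
    have rank: "(if la \<noteq> v then Suc rk else rk) = rank w p"
      using ls(3) step(2,5) by (simp add: la_def v_def rk_def S_def)
    define t where "t = slot w p"
    define u where "u = Suc w * \<tau> - 1 - p"
    define e where "e = b * (t mod slots)"
    have t: "2 * \<tau> * w + u = t" by (simp add: t_def u_def slot_def)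
    have u: "p \<le> Suc w * \<tau> - 1" "1 \<le> Suc w * \<tau>" using window_le(1)[OF window(1)] by linarith+
    have "2 * \<tau> * w \<le> (n + 10) * n" using \<tau>_less window by (intro mult_mono) auto
    then have mb: "2 * \<tau> * w \<le> Db" "Suc w * \<tau> \<le> 2 * Db" using bounds by (auto simp: algebra_simps)
    then have tb: "t \<le> 3 * Db" using t u_def by linarith
    have "e \<le> b * slots" unfolding e_def using slots_pos by (intro mult_left_mono) auto
    then have e: "e < n" using b_slots_less by linarith
    have cellS': "cell S' (t div slots) = cell S (t div slots) + rank w p * 2 ^ e"
      unfolding S(3) t_def e_def by (subst cell_insert) (use S(4) step(1) S_def in auto)
    \<comment> \<open>The packed value stays below \<open>2 ^ (b * slots) \<le> n\<close>, which
      bounds both the shifted rank and the sum.\<close>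
    moreover have "cell S' (t div slots) < n"
      using cell_less[OF S(2)] exp_slots less_le_trans by blast
    ultimately have cb: "rank w p * 2 ^ e < n" "cell S (t div slots) + rank w p * 2 ^ e < n" by linarith+
    have cellM: "M (Db + 4 + full + t div slots) = cell S (t div slots)"
      using fun_cong[OF M(6), of "t div slots"] by (simp add: cells_at_def)
    have tq: "t div slots \<le> t" by simp
    \<comment> \<open>For a letter met before in this window, rows 3 and 4 already have the right
      values.\<close>
    define M1 where "M1 = (if la \<noteq> v then M(3 * n + w := v, 4 * n + w := rank w p) else M)"
    define M2 where "M2 = M1(Db + 4 + full + t div slots := cell S' (t div slots))"
    have rkb: "rk < n" "rank w p < n"
      using rank rank_le[of w p] \<tau>_less by (auto split: if_splits)
    have IM: "I (Suc i) (R(21 := p, 22 := v, 23 := w, 24 := 3 * n + w, 25 := la, 26 := 4 * n + w,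
      29 := Db + 4 + full + t div slots, 28 := e, 27 := rank w p * 2 ^ e, 30 := cell S' (t div slots),
      20 := Suc i), M2)"
    proof -
      have "\<forall>i<n. M2 i = T ! i" "\<forall>i<n. M2 (n + i) = xs ! i"
        using Mxs bounds window by (auto simp: M2_def M1_def)
      moreover have "\<forall>w<n. M2 (3 * n + w) = last_seen (seen S' w)"
      proof (intro allI impI)
        fix w' assume "w' < n"
        then show "M2 (3 * n + w') = last_seen (seen S' w')"
          using Mxs(3) bounds window ls(1) M(3) step(2)[folded S'_def S_def] step(3)[folded S'_def S_def, of w']
          by (cases "w' = w") (auto simp: M2_def M1_def v_def la_def)
      qed
      moreover have "\<forall>w<n. M2 (4 * n + w) = card (seen S' w)"
      proof (intro allI impI)
        fix w' assume "w' < n"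
        then show "M2 (4 * n + w') = card (seen S' w')"
          using Mxs(4) bounds window M(4) step(5)[folded S'_def S_def] step(3)[folded S'_def S_def, of w'] rank
          by (cases "w' = w") (auto simp: M2_def M1_def)
      qed
      moreover have "cells_at M2 = cell S'"
      proof
        fix q
        have "cells_at M2 q = (if q = t div slots then cell S' q else cells_at M q)"
          using window bounds by (auto simp: cells_at_def M2_def M1_def)
        also have "\<dots> = cell S' q"
          unfolding M(6) S(3) cell_insert[OF S(4) step(1)[folded S_def]] by (auto simp: t_def)
        finally show "cells_at M2 q = cell S' q" .
      qed
      ultimately show ?thesis using R unfolding I_def S'_def[symmetric] by (auto simp: consts_def)
    qed
    have vb: "v < 2 ^ bw" using T_less_word[OF window(2)] by (simp add: v_def)
    have div_b: "p div \<tau> \<le> p" "i div 2 \<le> i" "i mod 2 \<le> 1" "t mod slots \<le> t" by auto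
    have ueq: "Suc w * \<tau> - 1 - p = u" by (simp add: u_def)
    obtain q where q: "t div slots = q" "q \<le> t" using tq by blast
    obtain m where m: "t mod slots = m" "m \<le> t" using mod_less_eq_dividend by blast
    have eeq: "b * m = e" by (simp add: e_def m(1))
    show "wp bw scan_body 32 (I (Suc i)) s"
    proof (cases "la = v")
      case True
      with rank have "rk = rank w p" by simp
      then show ?thesis
        using True R M IM vb div_b bounds window i t u mb tb e cb rkb cellM cellS' ueq eeq q m
        unfolding s scan_body_def
        by (simp add: wp_simps consts_def v_def[symmetric] M2_def M1_def)
    next
      case False
      with rank have "Suc rk = rank w p" by simp
      then show ?thesis
        using False R M IM vb div_b bounds window i t u mb tb e cb rkb cellM cellS' ueq eeq q m
        unfolding s scan_body_def
        by (simp add: wp_simps consts_def v_def[symmetric] M2_def M1_def)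
    qed
  next
    fix s assume "I (2 * n) s"
    then show "\<not> cmp_holds Lt (fst s 20) (fst s 12)" unfolding I_def consts_def by (cases s) auto
  next
    show "I 0 s" using s bounds unfolding I_def
      by (cases s) (auto simp: perm_inv_def scanned_def empty last_seen_def cells_at_def fun_eq_iff)
  next
    fix s assume "I (2 * n) s"
    moreover have "scanned xs (2 * n) = pairs" unfolding scanned_def by (rule scan_pair_inj(2)[OF xs])
    ultimately show "case s of (R, M) \<Rightarrow> consts R \<and> cells_at M = cell pairs"
      by (cases s) (simp add: I_def)
  qed simp
qed

end

section \<open>The table of minimal suffixes\<close>

text \<open>With \<open>B = 2 ^ b\<close>, after the first two instructions 21 is
  \<open>B ^ j\<close> and 22 is \<open>j\<close>. Then \<open>x mod B ^ j\<close> times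
  \<open>full div B ^ j = B ^ (\<tau> - j)\<close> is the padded suffix of length \<open>j\<close>.
  Registers 23 and 24 keep the least such value and its \<open>j\<close>.\<close>

definition "table_inner = seqs [
  Instr (Op Mul 21 21 8), Instr (Op Add 22 22 3), Instr (Op Mod 25 20 21), Instr (Op Div 26 9 21),
  Instr (Op Mul 25 25 26),
  If Lt 25 23 (seqs [Instr (Op Add 23 25 4), Instr (Op Add 24 22 4)]) Skip]"

text \<open>The initial minimum \<open>full\<close> exceeds every padded suffix, so the first suffix
  is always accepted. The inner loop runs once for each base \<open>2 ^ b\<close> digit of the
  index.\<close>

definition "table_body = seqs [
  Instr (Const 21 1), Instr (Const 22 0), Instr (Op Add 23 9 4), Instr (Const 24 0),
  While Le 21 20 table_inner,
  Instr (Op Add 25 16 20), Instr (Store 25 24), Instr (Op Add 20 20 3)]"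

definition "finish_prog = seqs [
  Instr (Store 15 2), Instr (Op Add 20 15 3), Instr (Store 20 7), Instr (Op Add 20 20 3),
  Instr (Store 20 11), Instr (Op Add 20 20 3), Instr (Const 21 4), Instr (Op Add 21 21 9),
  Instr (Store 20 21), Instr (Op Div 22 11 6), Instr (Op Div 23 0 2), Instr (Op Add 23 23 3),
  Instr (Op Div 23 23 22), Instr (Op Add 23 23 3), Instr (Op Add 1 21 23), Instr (Op Add 0 15 4)]"

definition "build_main k = seqs [setup_prog, seqs (replicate k pass_prog), Instr (Const 20 0),
  While Lt 20 12 scan_body, Instr (Const 20 0), While Lt 20 9 table_body, finish_prog]"

context min_suffix_params begin

definition "shifted x j = x mod (2 ^ b) ^ j * (2 ^ b) ^ (\<tau> - j)"

text \<open>The premise says that \<open>x\<close> has exactly \<open>l\<close> digits, so at most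
  one \<open>l\<close> is meant. Nothing is claimed for \<open>x = 0\<close>, which no fragment
  produces.\<close>

definition "table_spec x v \<longleftrightarrow> (\<forall>l. 1 \<le> l \<and> l \<le> \<tau> \<and> (2 ^ b) ^ (l - 1) \<le> x \<and> x < (2 ^ b) ^ l \<longrightarrow>
  1 \<le> v \<and> v \<le> l \<and> (\<forall>i. 1 \<le> i \<and> i \<le> l \<longrightarrow> shifted x v \<le> shifted x i))"

lemma full_eq: "full = (2 ^ b) ^ \<tau>"
  by (simp add: full_def power_mult)

lemma shifted_less: "j \<le> \<tau> \<Longrightarrow> shifted x j < full"
proof -
  assume j: "j \<le> \<tau>"
  have "x mod (2 ^ b) ^ j * (2 ^ b) ^ (\<tau> - j) < (2 ^ b) ^ j * (2 ^ b) ^ (\<tau> - j)"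
    by (intro mult_strict_right_mono) auto
  also have "\<dots> = full" using j by (simp flip: power_add add: full_eq)
  finally show ?thesis by (simp add: shifted_def)
qed

lemma wp_table_entry:
  assumes x: "x < full" and s: "consts R" "R 20 = x"
  shows "wp bw table_body (9 * \<tau> + 8) (\<lambda>(R', M'). consts R' \<and> R' 20 = Suc x \<and>
    (\<exists>v. table_spec x v \<and> M' = M(Db + 4 + x := v))) (R, M)"
proof -
  \<comment> \<open>The number of digits of \<open>x\<close>, which is the number of rounds of the
    loop.\<close>
  define L where "L = (LEAST l. x < (2 ^ b) ^ l)"
  have L: "x < (2 ^ b) ^ L" unfolding L_def by (rule LeastI[of _ \<tau>]) (use x full_eq in simp)
  have lessL: "(2 ^ b) ^ i \<le> x" if "i < L" for i
    using not_less_Least[OF that[unfolded L_def]] by simp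
  have L_le: "L \<le> \<tau>" unfolding L_def by (rule Least_le) (use x full_eq in simp)
  have L_unique: "l = L" if "1 \<le> l" "(2 ^ b) ^ (l - 1) \<le> x" "x < (2 ^ b) ^ l" for l
  proof (rule antisym)
    show "L \<le> l" using that(3) unfolding L_def by (rule Least_le)
    show "l \<le> L"
    proof (rule ccontr)
      assume "\<not> l \<le> L"
      then have "((2::nat) ^ b) ^ L \<le> (2 ^ b) ^ (l - 1)" by (intro power_increasing) auto
      with that(2) L show False by linarith
    qed
  qed
  define J where "J = (\<lambda>i (R, M'). consts R \<and> R 20 = x \<and> R 21 = (2 ^ b) ^ i \<and> R 22 = i \<and> M' = M \<and>
    R 23 \<le> full \<and> (if i = 0 then R 23 = full else 1 \<le> R 24 \<and> R 24 \<le> i \<and> R 23 = shifted x (R 24) \<and>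
      (\<forall>j. 1 \<le> j \<and> j \<le> i \<longrightarrow> R 23 \<le> shifted x j)))"
  have inner: "wp bw (While Le 21 20 table_inner) (9 * \<tau> + 1) (J L) s" if "J 0 s" for s
  proof (rule wp_While[where I = J and N = L and f = "\<lambda>_. 8"])
    fix i s assume i: "i < L" and J: "J i s"
    obtain R M' where s: "s = (R, M')" by fastforce
    show "cmp_holds Le (fst s 21) (fst s 20)" using J lessL[OF i] by (simp add: J_def s)
    have iL: "Suc i \<le> \<tau>" using i L_le by simp
    have full_div: "full div (2 ^ b) ^ Suc i = (2 ^ b) ^ (\<tau> - Suc i)"
      unfolding full_eq using iL by (simp add: power_diff)
    have le_full: "((2::nat) ^ b) ^ Suc i \<le> full" "((2::nat) ^ b) ^ (\<tau> - Suc i) \<le> full"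
      unfolding full_eq using iL by (intro power_increasing; simp)+
    define P' where "P' = ((2::nat) ^ b) ^ Suc i"
    have pw: "((2::nat) ^ b) ^ i * 2 ^ b = P'" by (simp add: P'_def)
    define y where "y = shifted x (Suc i)"
    have y: "x mod P' * (full div P') = y" "y < full"
      using shifted_less[OF iL, of x] full_div by (simp_all add: y_def shifted_def P'_def)
    have m: "x mod P' \<le> x" "full div P' \<le> full" by auto
    obtain x1 where x1: "x mod P' = x1" "x1 \<le> x" using m by blast
    obtain x2 where x2: "full div P' = x2" "x2 \<le> full" using m by blast
    have R: "consts R" "R 20 = x" "R 21 = (2 ^ b) ^ i" "R 22 = i" "M' = M" "R 23 \<le> full"
      using J by (auto simp: J_def s)
    show "wp bw table_inner 8 (J (Suc i)) s"
    proof (cases "y < R 23")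
      case True
      have lt: "shifted x (Suc i) < shifted x j" if "1 \<le> j" "j \<le> i" for j
        using J True that by (auto simp: J_def s y_def split: if_splits)
      have "J (Suc i) (R(21 := P', 22 := Suc i, 26 := x2, 25 := y, 23 := y, 24 := Suc i), M')"
        using J y lt by (auto simp: J_def s P'_def y_def consts_def le_Suc_eq less_imp_le)
      then show ?thesis
        using True R y x1 x2 bounds iL x le_full(1)[folded P'_def] pw unfolding s table_inner_def
        by (simp add: wp_simps consts_def)
    next
      case False
      then have "i \<noteq> 0" using J y(2) by (cases "i = 0") (auto simp: J_def s)
      then have "J (Suc i) (R(21 := P', 22 := Suc i, 26 := x2, 25 := y), M')"
        using J y False by (auto simp: J_def s P'_def y_def consts_def le_Suc_eq)
      then show ?thesis
        using False R y x1 x2 bounds iL x le_full(1)[folded P'_def] pw unfolding s table_inner_def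
        by (simp add: wp_simps consts_def)
    qed
  next
    fix s assume "J L s"
    then show "\<not> cmp_holds Le (fst s 21) (fst s 20)" using L by (cases s) (auto simp: J_def)
  qed (use that L_le in auto)
  have last: "wp bw (seqs [Instr (Op Add 25 16 20), Instr (Store 25 24), Instr (Op Add 20 20 3)]) 3
    (\<lambda>(R', M'). consts R' \<and> R' 20 = Suc x \<and> (\<exists>v. table_spec x v \<and> M' = M(Db + 4 + x := v))) s"
    if "J L s" for s
  proof -
    obtain R M' where s: "s = (R, M')" by fastforce
    have R: "consts R" "R 20 = x" "M' = M" using that by (auto simp: J_def s)
    have "table_spec x (R 24)"
      unfolding table_spec_def
    proof (intro allI impI)
      fix l assume l: "1 \<le> l \<and> l \<le> \<tau> \<and> (2 ^ b) ^ (l - 1) \<le> x \<and> x < (2 ^ b) ^ l"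
      with L_unique have "l = L" by blast
      then show "1 \<le> R 24 \<and> R 24 \<le> l \<and> (\<forall>i. 1 \<le> i \<and> i \<le> l \<longrightarrow> shifted x (R 24) \<le> shifted x i)"
        using that l by (auto simp: J_def s)
    qed
    then show ?thesis
      using R bounds x unfolding s by (simp add: wp_simps consts_def) blast
  qed
  have "J 0 (R(21 := 1, 22 := 0, 23 := full, 24 := 0), M)"
    using s by (auto simp: J_def consts_def)
  from wp_SeqI'[OF inner[OF this] last] show ?thesis
    unfolding table_body_def using s bounds by (simp add: wp_simps consts_def)
qed

lemma wp_table:
  assumes s: "consts (fst s)" "fst s 20 = 0" "cells_at (snd s) = cell pairs"
  shows "wp bw (While Lt 20 9 table_body) (18 * n + 1)
    (\<lambda>(R, M). consts R \<and> cells_at M = cell pairs \<and> (\<forall>x<full. table_spec x (M (Db + 4 + x)))) s"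
proof -
  define I where "I = (\<lambda>x (R, M). consts R \<and> R 20 = x \<and> cells_at M = cell pairs \<and>
    (\<forall>x'<x. table_spec x' (M (Db + 4 + x'))))"
  show ?thesis
  proof (rule wp_While[where I = I and N = full and f = "\<lambda>_. 9 * \<tau> + 8"])
    fix x s assume x: "x < full" and I: "I x s"
    obtain R M where s: "s = (R, M)" by fastforce
    show "cmp_holds Lt (fst s 20) (fst s 9)" using I x by (simp add: I_def s consts_def)
    show "wp bw table_body (9 * \<tau> + 8) (I (Suc x)) s"
      unfolding s
    proof (rule wp_mono[OF wp_table_entry[OF x]])
      fix s' :: state
      assume s': "case s' of (R', M') \<Rightarrow> consts R' \<and> R' 20 = Suc x \<and>
        (\<exists>v. table_spec x v \<and> M' = M(Db + 4 + x := v))"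
      have "cells_at (M(Db + 4 + x := v)) = cells_at M" for v
        using x by (auto simp: cells_at_def)
      then show "I (Suc x) s'" using s' I by (cases s') (auto simp: I_def s less_Suc_eq)
    qed (use I in \<open>auto simp: I_def s\<close>)
  next
    fix s assume "I full s"
    then show "\<not> cmp_holds Lt (fst s 20) (fst s 9)" by (cases s) (simp add: I_def consts_def)
  next
    \<comment> \<open>From \<open>\<tau> < full\<close> follows
      \<open>\<tau> * full \<le> full * full \<le> n\<close>: brute force is affordable because the
      table has at most \<open>sqrt n\<close> entries.\<close>
    have "(\<Sum>i<full. 9 * \<tau> + 8 + 1) + 1 = 9 * (\<tau> * full) + 9 * full + 1" by (simp add: algebra_simps)
    then show "(\<Sum>i<full. 9 * \<tau> + 8 + 1) + 1 \<le> 18 * n + 1" using \<tau>_full full_less by linarith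
  qed (use s in \<open>auto simp: I_def split: prod.splits\<close>)
qed

text \<open>A query uses a window with index at most \<open>Suc (n div \<tau>)\<close>, and window
  \<open>w\<close> lies in cell \<open>w div P\<close>; the outer \<open>Suc\<close> accounts for
  cell \<open>0\<close>.\<close>

definition "num_cells = Suc (Suc (n div \<tau>) div P)"

text \<open>A query is given \<open>l\<close> and \<open>r\<close> only. The parameters \<tau>,
  \<open>b\<close> and \<open>slots\<close> and the start of the cells are therefore stored in four
  words before the table.\<close>

definition "valid_structure D \<longleftrightarrow> length D = 4 + full + num_cells \<and>
  D ! 0 = \<tau> \<and> D ! 1 = b \<and> D ! 2 = slots \<and> D ! 3 = 4 + full \<and>
  (\<forall>x<full. table_spec x (D ! (4 + x))) \<and> (\<forall>q<num_cells. D ! (4 + full + q) = cell pairs q)"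

lemma num_cells_le: "num_cells \<le> n"
proof -
  have "Suc (n div \<tau>) div P \<le> Suc (n div \<tau>)" by simp
  moreover have "n div \<tau> \<le> n div 2" using \<tau>_ge by (intro div_le_mono2) auto
  ultimately show ?thesis unfolding num_cells_def using n_ge by linarith
qed

lemma wp_finish:
  assumes s: "consts R" "cells_at M = cell pairs" "\<forall>x<full. table_spec x (M (Db + 4 + x))"
  shows "wp bw finish_prog 16 (\<lambda>(R, M). valid_structure (map M [R 0..<R 0 + R 1])) (R, M)"
proof -
  have sl: "slots div (2 * \<tau>) = P" using \<tau>_ge by (simp add: slots_def)
  have d: "n div \<tau> \<le> n" by simp
  obtain q1 where q1: "n div \<tau> = q1" "q1 \<le> n" using d by blast
  have "Suc q1 div P \<le> Suc q1" by simp
  then obtain q2 where q2: "Suc q1 div P = q2" "q2 \<le> Suc q1" by blast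
  have nc: "num_cells = Suc q2" by (simp add: num_cells_def q1 q2)
  define M' where "M' = M(Db := \<tau>, Suc Db := b, Suc (Suc Db) := slots, Suc (Suc (Suc Db)) := 4 + full)"
  have M': "M' (Db + i) = [\<tau>, b, slots, 4 + full] ! i" if "i < 4" for i
    using that by (auto simp: M'_def less_Suc_eq numeral_eq_Suc)
  have M'2: "M' (Db + 4 + a) = M (Db + 4 + a)" for a
    by (simp add: M'_def)
  let ?D = "map M' [Db..<Db + (4 + full + num_cells)]"
  have nth: "?D ! i = M' (Db + i)" if "i < 4 + full + num_cells" for i
    using that by simp
  have "valid_structure ?D"
    unfolding valid_structure_def
  proof (intro conjI allI impI)
    show "table_spec x (?D ! (4 + x))" if "x < full" for x
      using nth[of "4 + x"] M'2[of x] s(3) that by (simp only: add.assoc[symmetric])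
    show "?D ! (4 + full + q) = cell pairs q" if "q < num_cells" for q
      using nth[of "4 + full + q"] M'2[of "full + q"] fun_cong[OF s(2), of q] that
      by (simp add: cells_at_def add.assoc del: nth_map)
    show "?D ! 0 = \<tau>" "?D ! 1 = b" "?D ! 2 = slots" "?D ! 3 = 4 + full"
      using nth[of 0] nth[of 1] nth[of 2] nth[of 3] M'[of 0] M'[of 1] M'[of 2] M'[of 3]
      by (simp_all del: nth_map)
  qed simp
  then show ?thesis
    using s(1) bounds sl q1 q2 unfolding finish_prog_def
    by (simp add: wp_simps consts_def nc M'_def add.assoc)
qed

lemma wp_build_main:
  assumes "R 0 = n" "R 2 = \<tau>" "R 3 = 1" "M = nth_default 0 T"
  shows "wp bw (build_main k) ((120 + 30 * k) * n)
    (\<lambda>(R, M). valid_structure (map M [R 0..<R 0 + R 1])) (R, M)"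
proof -
  define xs where "xs = radix_sort ((!) T) n k [0..<n]"
  have n0: "0 < n" using n_ge by simp
  have xs: "mset xs = mset [0..<n]" "sorted (map ((!) T) xs)"
    unfolding xs_def by (rule mset_radix_sort[OF n0], rule sorted_radix_sort[OF n0]) (simp add: T_less)
  define I1 where "I1 = (\<lambda>(R, M). consts R \<and> R 19 = 1 \<and> perm_inv [0..<n] M)"
  define I2 where "I2 = (\<lambda>(R, M). consts R \<and> perm_inv xs M)"
  define I3 where "I3 = (\<lambda>(R, M). consts R \<and> cells_at M = cell pairs)"
  define I4 where "I4 = (\<lambda>(R, M). consts R \<and> cells_at M = cell pairs \<and>
    (\<forall>x<full. table_spec x (M (Db + 4 + x))))"
  let ?Q = "\<lambda>(R, M). valid_structure (map M [R 0..<R 0 + R 1])"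
  have A: "wp bw setup_prog (20 * n) I1 (R, M)"
    unfolding I1_def by (rule wp_setup) (use assms in auto)
  have B: "wp bw (seqs (replicate k pass_prog)) (30 * n * k) I2 s" if "I1 s" for s
    using wp_sort[of 0 k s] that by (cases s) (auto simp: I1_def I2_def xs_def)
  have C: "wp bw (Seq (Instr (Const 20 0)) p) t Q s"
    if "consts (fst s)" "\<And>s'. consts (fst s') \<Longrightarrow> fst s' 20 = 0 \<Longrightarrow> snd s' = snd s \<Longrightarrow> wp bw p (t - 1) Q s'" "1 \<le> t"
    for p t Q s
  proof -
    obtain R M where s: "s = (R, M)" by fastforce
    have "consts (R(20 := 0))" using that(1) by (simp add: s consts_def)
    then show ?thesis using that by (simp add: s wp_simps)
  qed
  have E: "wp bw (Seq (While Lt 20 9 table_body) (Seq finish_prog Skip)) (18 * n + 1 + 16) ?Q s"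
    if "consts (fst s)" "fst s 20 = 0" "cells_at (snd s) = cell pairs" for s
  proof (rule wp_SeqI'[where I = I4])
    show "wp bw (While Lt 20 9 table_body) (18 * n + 1) I4 s"
      unfolding I4_def by (rule wp_table[OF that])
    show "wp bw (Seq finish_prog Skip) 16 ?Q s'" if "I4 s'" for s'
    proof (rule wp_SeqI[where u = 0])
      show "wp bw finish_prog 16 ?Q s'"
        using that wp_finish by (cases s') (simp add: I4_def)
    qed (simp_all add: wp_Skip)
  qed
  have D: "wp bw (Seq (While Lt 20 12 scan_body) (Seq (Instr (Const 20 0))
      (Seq (While Lt 20 9 table_body) (Seq finish_prog Skip)))) (66 * n + 1 + (18 * n + 1 + 16 + 1)) ?Q s"
    if "consts (fst s)" "fst s 20 = 0" "perm_inv xs (snd s)" for s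
  proof (rule wp_SeqI'[where I = I3])
    show "wp bw (While Lt 20 12 scan_body) (66 * n + 1) I3 s"
      unfolding I3_def by (rule wp_scan[OF xs that])
    show "wp bw (Seq (Instr (Const 20 0)) (Seq (While Lt 20 9 table_body) (Seq finish_prog Skip)))
        (18 * n + 1 + 16 + 1) ?Q s'" if "I3 s'" for s'
      by (rule C) (use that in \<open>auto simp: I3_def intro!: wp_mono[OF E]\<close>)
  qed
  have "wp bw (build_main k) (20 * n + (30 * n * k + (66 * n + 1 + (18 * n + 1 + 16 + 1) + 1))) ?Q (R, M)"
    unfolding build_main_def seqs.simps(2)[of setup_prog] seqs.simps(2)[of "seqs (replicate k pass_prog)"]
  proof (rule wp_SeqI'[OF A], rule wp_SeqI'[OF B])
    show "wp bw (seqs [Instr (Const 20 0), While Lt 20 12 scan_body, Instr (Const 20 0),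
        While Lt 20 9 table_body, finish_prog]) (66 * n + 1 + (18 * n + 1 + 16 + 1) + 1) ?Q s" if "I2 s" for s
      unfolding seqs.simps
      by (rule C) (use that in \<open>auto simp: I2_def intro!: wp_mono[OF D]\<close>)
  qed
  then show ?thesis
    by (rule wp_mono) (use n_ge in \<open>auto simp: algebra_simps\<close>)
qed

end

section \<open>Queries\<close>

text \<open>Register 9 is the slot of position \<open>r\<close>, the lowest digit of the fragment.
  The final \<open>Const 6 4\<close> is the offset of the table behind the header.\<close>

definition "query_main = seqs [
  Instr (Const 3 1), Instr (Const 4 0), Instr (Load 2 4), Instr (Load 7 3), Instr (Const 5 2),
  Instr (Load 11 5), Instr (Const 6 3), Instr (Load 17 6),
  Instr (Op Div 8 0 2), Instr (Op Add 8 8 3), Instr (Op Add 9 2 2), Instr (Op Mul 9 9 8),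
  Instr (Op Add 10 8 3), Instr (Op Mul 10 10 2), Instr (Op Sub 10 10 3), Instr (Op Sub 10 10 1),
  Instr (Op Add 9 9 10), Instr (Op Div 10 9 11), Instr (Op Add 10 17 10), Instr (Load 10 10),
  Instr (Op Mod 9 9 11), Instr (Op Mul 9 7 9), Instr (Op Shr 10 10 9), Instr (Op Sub 12 1 0),
  Instr (Op Add 12 12 3), Instr (Op Mul 12 7 12), Instr (Op Shl 12 3 12), Instr (Op Mod 10 10 12),
  Instr (Const 6 4), Instr (Op Add 10 6 10), Instr (Load 0 10)]"

text \<open>A single letter is answered without any access to memory, so the same program also works
  on the empty structure for \<open>\<tau> = 1\<close>.\<close>

definition "query_prog = seqs [If Eq 0 1 (seqs [Instr (Const 0 1)]) query_main]"

text \<open>The reversal reconciles two conventions: strings begin with the most significant digit,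
  cells count digits from the least significant one.\<close>

lemma digits_val_eq_sum: "digits_val B u = (\<Sum>i<length u. rev u ! i * B ^ i)"
proof (induction u rule: rev_induct)
  case (snoc a u)
  have "(\<Sum>i<length (u @ [a]). rev (u @ [a]) ! i * B ^ i) = a + (\<Sum>i<length u. rev u ! i * B ^ Suc i)"
    by (simp add: sum.lessThan_Suc_shift del: sum.lessThan_Suc)
  then show ?case by (simp add: snoc digits_val_snoc sum_distrib_left mult_ac)
qed (simp add: digits_val_Nil)

lemma fragment_eq_map:
  assumes "l \<le> r" "r < length T" shows "fragment T l r = map ((!) T) [l..<Suc r]"
  unfolding fragment_def using assms by (intro nth_equalityI) (auto simp del: upt_Suc)

lemma wp_query_singleton:
  assumes "1 < (2::nat) ^ bw" "l < length T"
  shows "wp bw query_prog 3 (\<lambda>(R, M). R 0 = length (min_suffix (fragment T l l))) (init [l, l] D)"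
proof -
  have "length (fragment T l l) = 1" using assms by (simp add: fragment_def)
  then obtain a where a: "fragment T l l = [a]" by (auto simp: length_Suc_conv)
  have "min_suffix [a] = [a]" by (rule min_suffixI) (auto simp: suffix_Cons)
  then show ?thesis using a assms unfolding query_prog_def init_def
    by (simp add: wp_simps nth_default_def)
qed

context min_suffix_params begin

lemma fragment_window:
  assumes "l \<le> p" "p \<le> r" "r < n" "Suc r - l \<le> \<tau>" shows "p \<in> window (Suc (l div \<tau>))"
proof -
  have "l div \<tau> \<le> p div \<tau>" using assms(1) by (rule div_le_mono)
  moreover have "p div \<tau> \<le> (l + \<tau>) div \<tau>" using assms by (intro div_le_mono) linarith
  then have "p div \<tau> \<le> Suc (l div \<tau>)" using \<tau>_ge by simp
  ultimately show ?thesis using assms by (auto simp: window_def)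
qed

text \<open>The number cut out of the cell is the value of the rank string of the fragment. It has
  exactly as many digits as the fragment has letters, so its table entry refers to this fragment,
  and ranks give the same minimal suffix length as letters.\<close>

lemma query_correct:
  assumes lr: "l \<le> r" "r < n" "Suc r - l \<le> \<tau>"
  defines "w \<equiv> Suc (l div \<tau>)"
  defines "s \<equiv> slot w r"
  defines "x \<equiv> cell pairs (s div slots) div 2 ^ (b * (s mod slots)) mod 2 ^ (b * (Suc r - l))"
  shows "s div slots < num_cells" "x < full"
    "table_spec x v \<Longrightarrow> v = length (min_suffix (fragment T l r))"
proof -
  let ?B = "(2::nat) ^ b"
  define len where "len = Suc r - l"
  have len: "1 \<le> len" "len \<le> \<tau>" using lr by (auto simp: len_def)
  have win: "p \<in> window w" if "l \<le> p" "p \<le> r" for p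
    unfolding w_def using fragment_window[OF that lr(2,3)] .
  have r_win: "r \<in> window w" and l_win: "l \<in> window w" using win lr by auto
  have slot: "slot w (r - i) = s + i" if "i < len" for i
  proof -
    have "Suc w * \<tau> - 1 - (r - i) = Suc w * \<tau> - 1 - r + i"
      using window_le(1)[OF r_win] that lr unfolding len_def by linarith
    then show ?thesis unfolding s_def slot_def by simp
  qed
  have s_div: "s div (2 * \<tau>) = w" unfolding s_def by (rule slot_less(2)[OF r_win])
  have s_mod: "s mod (2 * \<tau>) = Suc w * \<tau> - 1 - r"
    using slot_less(1)[OF r_win] unfolding s_def slot_def by simp
  have slots_eq: "slots = 2 * \<tau> * P" by (simp add: slots_def)
  have "s div slots = w div P" unfolding slots_eq div_mult2_eq[of s "2 * \<tau>" P] s_div ..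
  also have "\<dots> \<le> Suc (n div \<tau>) div P" unfolding w_def using lr by (intro div_le_mono Suc_le_mono[THEN iffD2]) simp
  finally show "s div slots < num_cells" by (simp add: num_cells_def)
  have "s mod slots = 2 * \<tau> * (w mod P) + (Suc w * \<tau> - 1 - r)"
    unfolding slots_eq mod_mult2_eq[of s "2 * \<tau>" P] s_div s_mod ..
  moreover have "2 * \<tau> * Suc (w mod P) \<le> slots"
    unfolding slots_eq using P_ge by (intro mult_left_mono) (auto simp: Suc_le_eq)
  moreover have "Suc w * \<tau> - 1 - r + len \<le> 2 * \<tau>"
    using slot_less(1)[OF l_win] window_le(1)[OF r_win] lr by (simp add: len_def)
  \<comment> \<open>Since \<open>slots\<close> is a multiple of \<open>2 * \<tau>\<close>, a window
    lies within one cell, and so do the digits from \<open>r\<close> up to \<open>l\<close>.\<close>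
  ultimately have fits: "s mod slots + len \<le> slots" by simp
  have "x = (\<Sum>i<slots. slot_digit pairs (s div slots * slots + i) * ?B ^ i) div ?B ^ (s mod slots) mod ?B ^ len"
    unfolding x_def cell_eq[OF order_refl] power_mult len_def ..
  also have "\<dots> = (\<Sum>i<len. slot_digit pairs (s div slots * slots + (s mod slots + i)) * ?B ^ i)"
    by (rule sum_digits_div_mod[OF slot_digit_less[OF order_refl] fits])
  also have "\<dots> = (\<Sum>i<len. rank w (r - i) * ?B ^ i)"
  proof (rule sum.cong[OF refl])
    fix i assume i: "i \<in> {..<len}"
    have "s div slots * slots + (s mod slots + i) = slot w (r - i)"
      using slot[of i] i div_mult_mod_eq[of s slots] by simp
    moreover have "(w, r - i) \<in> pairs" using i lr win[of "r - i"] by (auto simp: pairs_def len_def)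
    ultimately show "slot_digit pairs (s div slots * slots + (s mod slots + i)) * ?B ^ i = rank w (r - i) * ?B ^ i"
      using slot_digit_eq[OF order_refl] by simp
  qed
  finally have x_sum: "x = (\<Sum>i<len. rank w (r - i) * ?B ^ i)" .
  \<comment> \<open>The rank as a function of the letter instead of the position, as
    \<open>min_suffix_map\<close> requires.\<close>
  define f where "f y = card {z \<in> (!) T ` window w. z \<le> y}" for y
  define u where "u = map f (fragment T l r)"
  have frag: "fragment T l r = map ((!) T) [l..<Suc r]"
    using fragment_eq_map[OF lr(1), of T] lr length_T by simp
  have u: "length u = len" "rev u ! i = rank w (r - i)" if "i < len" for i
    using that lr by (auto simp: u_def frag len_def rev_nth f_def rank_def simp del: upt_Suc)
  have len_u: "length u = len" using u(1)[of 0] len by simp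
  have x: "x = digits_val ?B u"
    unfolding x_sum digits_val_eq_sum len_u by (intro sum.cong) (auto simp: u)
  have u_digits: "0 < a \<and> a < ?B" if a: "a \<in> set u" for a
  proof -
    obtain p where "p \<in> {l..<Suc r}" "a = f (T ! p)"
      using a unfolding u_def frag by (auto simp del: upt_Suc)
    then have "l \<le> p" "p \<le> r" "a = rank w p" by (auto simp: f_def rank_def)
    then show ?thesis using rank_pos[OF win] rank_less by auto
  qed
  have x_less: "x < ?B ^ len" unfolding x len_u[symmetric] using u_digits by (intro digits_val_less) auto
  also have "\<dots> \<le> full" unfolding full_eq using len by (intro power_increasing) auto
  finally show "x < full" .
  have u_ne: "u \<noteq> []" using len_u len by auto
  \<comment> \<open>The leading rank is at least \<open>1\<close>; with \<open>x_less\<close> this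
    fixes the number of digits as \<open>len\<close>.\<close>
  have x_ge: "?B ^ (len - 1) \<le> x"
    unfolding x len_u[symmetric] using u_ne u_digits[of "hd u"] by (intro digits_val_ge) auto
  have mono: "strict_mono_on (set (fragment T l r)) f"
  proof (rule strict_mono_onI)
    fix y y' assume "y \<in> set (fragment T l r)" "y' \<in> set (fragment T l r)" "y < y'"
    then obtain p p' where "l \<le> p'" "p' \<le> r" "y = T ! p" "y' = T ! p'" unfolding frag by auto
    then show "f y < f y'" using rank_strict_mono[OF win, of p' p] \<open>y < y'\<close> by (simp add: f_def rank_def)
  qed
  assume "table_spec x v"
  then have v: "1 \<le> v" "v \<le> len" "\<And>i. 1 \<le> i \<Longrightarrow> i \<le> len \<Longrightarrow> shifted x v \<le> shifted x i"
    unfolding table_spec_def using len x_ge x_less by blast+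
  have "length (min_suffix u) = v"
  proof (rule length_min_suffix_eq[OF u_ne, of ?B \<tau>])
    show "\<forall>a\<in>set u. 0 < a \<and> a < ?B" using u_digits by blast
    show "digits_val ?B u mod ?B ^ v * ?B ^ (\<tau> - v) \<le> digits_val ?B u mod ?B ^ i * ?B ^ (\<tau> - i)"
      if "1 \<le> i" "i \<le> length u" for i
      using v(3)[of i] that len_u unfolding shifted_def x by simp
  qed (use v len len_u in auto)
  moreover have "min_suffix u = map f (min_suffix (fragment T l r))"
    unfolding u_def using mono u_ne by (intro min_suffix_map) (auto simp: u_def)
  ultimately show "v = length (min_suffix (fragment T l r))" by simp
qed

lemma wp_query:
  assumes lr: "l \<le> r" "r < n" "Suc r - l \<le> \<tau>" and D: "valid_structure D"
  shows "wp bw query_prog 33 (\<lambda>(R, M). R 0 = length (min_suffix (fragment T l r))) (init [l, r] D)"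
proof (cases "l = r")
  case True
  then show ?thesis
    using wp_query_singleton[of bw l T D] lr length_T bounds by (auto intro: wp_mono)
next
  case False
  define w where "w = Suc (l div \<tau>)"
  define s where "s = slot w r"
  define len where "len = Suc r - l"
  define c where "c = cell pairs (s div slots)"
  define x where "x = c div 2 ^ (b * (s mod slots)) mod 2 ^ (b * len)"
  note q = query_correct[OF lr, folded w_def, folded s_def, folded c_def len_def, folded x_def]
  have r_win: "r \<in> window w" unfolding w_def using fragment_window lr by blast
  have Dlen: "length D = 4 + full + num_cells" using D by (simp add: valid_structure_def)
  define M where "M = nth_default 0 D"
  have M: "M 0 = \<tau>" "M 1 = b" "M 2 = slots" "M 3 = 4 + full"
    "M (4 + full + s div slots) = c" "M (4 + x) = length (min_suffix (fragment T l r))"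
    using D q unfolding M_def valid_structure_def c_def
    by (auto simp: nth_default_def)
  define R where "R = nth_default 0 [l, r]"
  have R: "R 0 = l" "R 1 = r" by (simp_all add: R_def nth_default_def)
  define u where "u = Suc w * \<tau> - 1 - r"
  have s: "2 * \<tau> * w + u = s" by (simp add: s_def u_def slot_def)
  have u: "r \<le> Suc w * \<tau> - 1" "1 \<le> Suc w * \<tau>" using window_le(1)[OF r_win] by linarith+
  have d: "l div \<tau> \<le> l" by simp
  have "l div \<tau> < n" by (rule le_less_trans[OF div_le_dividend]) (use lr in simp)
  then have "w \<le> n" by (simp add: w_def)
  then have "2 * \<tau> * w \<le> (n + 10) * n" "Suc w * \<tau> \<le> (n + 10) * n"
    using \<tau>_less by (intro mult_mono; simp)+
  then have mb: "2 * \<tau> * w \<le> Db" "Suc w * \<tau> \<le> Db" using bounds by auto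
  obtain q1 where q1: "s div slots = q1" "q1 \<le> s" using div_le_dividend by blast
  obtain m where m: "s mod slots = m" "m \<le> s" using mod_less_eq_dividend by blast
  have "b * m \<le> b * slots" using slots_pos m(1) by (intro mult_left_mono) auto
  then have bm: "b * m < n" using b_slots_less by linarith
  have c_less: "c < n" unfolding c_def using cell_less[OF order_refl] exp_slots less_le_trans by blast
  obtain c' where c': "c div 2 ^ (b * m) = c'" "c' \<le> c" using div_le_dividend by blast
  have len: "len \<le> \<tau>" "r - l + 1 = len" using lr by (auto simp: len_def)
  have "(2::nat) ^ (b * len) \<le> full" unfolding full_def using len by (intro power_increasing mult_left_mono) auto
  then have blen: "(2::nat) ^ (b * len) < n" "b * len < n"
    using full_less less_exp[of "b * len"] by linarith+
  have "(2::nat) ^ (b * len) < 2 ^ bw" using blen bounds by linarith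
  then have bl: "b * len < bw" by simp
  have x: "c' mod 2 ^ (b * len) = x" by (simp add: x_def m c')
  have ueq: "Suc w * \<tau> - 1 - r = u" by (simp add: u_def)
  have weq: "Suc (l div \<tau>) = w" by (simp add: w_def)
  have nu: "num_cells \<le> n" by (rule num_cells_le)
  have "wp bw query_main 32 (\<lambda>(R, M). R 0 = length (min_suffix (fragment T l r))) (R, M)"
    using M R s u d mb q1 m bm c_less c' len blen bl x ueq weq bounds lr q(2) \<open>w \<le> n\<close>
    unfolding query_main_def
    by (simp add: wp_simps mult_2[symmetric, of \<tau>])
  then have "wp bw (Seq query_main Skip) 32 (\<lambda>(R, M). R 0 = length (min_suffix (fragment T l r))) (R, M)"
    by (rule wp_SeqI[where u = 0]) (simp_all add: wp_Skip)
  then show ?thesis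
    using False R unfolding query_prog_def init_def M_def[symmetric] R_def[symmetric]
    by (simp add: wp_simps)
qed

end

section \<open>Choice of the parameters\<close>

definition "build_prog k = seqs [Instr (Const 3 1),
  If Eq 2 3 (seqs [Instr (Const 0 0), Instr (Const 1 0)]) (build_main k)]"

lemma wp_build_one:
  assumes "1 < (2::nat) ^ bw"
  shows "wp bw (build_prog k) 4 (\<lambda>(R, M). map M [R 0..<R 0 + R 1] = []) (init [n, \<sigma>, 1] T)"
  using assms unfolding build_prog_def init_def by (simp add: wp_simps nth_default_def numeral_2_eq_2)

lemma fits_init:
  assumes "\<And>x. x \<in> set xs \<Longrightarrow> x < 2 ^ bw" "\<And>y. y \<in> set ys \<Longrightarrow> y < 2 ^ bw"
  shows "fits bw (init xs ys)"
  unfolding fits_def init_def using assms by (auto simp: nth_default_def)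

context min_suffix_params begin

lemma wp_build: "wp bw (build_prog k) ((122 + 30 * k) * n)
  (\<lambda>(R, M). valid_structure (map M [R 0..<R 0 + R 1])) (init [n, \<sigma>, \<tau>] T)"
proof -
  define R where "R = nth_default 0 [n, \<sigma>, \<tau>]"
  have R: "R 0 = n" "R 2 = \<tau>" by (simp_all add: R_def nth_default_def numeral_2_eq_2)
  let ?Q = "\<lambda>(R, M). valid_structure (map M [R 0..<R 0 + R 1])"
  have "wp bw (build_main k) ((120 + 30 * k) * n) ?Q (R(3 := 1), nth_default 0 T)"
    by (rule wp_build_main) (use R in auto)
  then have "wp bw (Seq (build_main k) Skip) ((122 + 30 * k) * n - 2) ?Q (R(3 := 1), nth_default 0 T)"
    by (rule wp_SeqI[where u = 0]) (use n_ge in \<open>simp_all add: wp_Skip algebra_simps\<close>)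
  moreover have "1 \<le> (122 + 30 * k) * n" "1 \<le> (122 + 30 * k) * n - 1"
    using n_ge by (simp_all add: algebra_simps)
  ultimately show ?thesis
    using R \<tau>_ge bounds unfolding build_prog_def init_def R_def[symmetric]
    by (simp add: wp_simps numeral_2_eq_2)
qed

text \<open>The constant is \<open>15 = 12 + 3\<close>. For the cells, maximality of
  \<open>P\<close> gives \<open>log 2 n \<le> 4 * b * \<tau> * P\<close>, and
  \<open>b \<le> 3 * log 2 \<tau>\<close> yields \<open>12\<close>. The \<open>3\<close> covers the
  table, four words of header and two cells from rounding, together at most
  \<open>3 * sqrt n\<close>, by \<open>sqrt n \<le> n / log 2 n\<close>.\<close>

lemma size_bound:
  assumes D: "valid_structure D" and sqrt: "log 2 (real n) \<le> sqrt (real n)"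
  shows "real (length D) \<le> 15 * (real n * log 2 (real \<tau>) / log 2 (real n))"
proof -
  have n0: "16 \<le> real n" using n_ge by simp
  have "log 2 16 = (4::real)" using log_of_power_eq[of 16 2 4] by simp
  then have ln: "4 \<le> log 2 (real n)" using log_le_cancel_iff[of 2 16 "real n"] n0 by simp
  have lt: "1 \<le> log 2 (real \<tau>)" using \<tau>_ge log_le_cancel_iff[of 2 2 "real \<tau>"] by simp
  have b: "real b \<le> 3 * log 2 (real \<tau>)"
  proof -
    have "(2::real) ^ b \<le> 4 * real \<tau>" using b_le by (metis of_nat_le_iff of_nat_mult of_nat_numeral of_nat_power)
    then have "log 2 (2 ^ b) \<le> log 2 (4 * real \<tau>)" using \<tau>_ge by (subst log_le_cancel_iff) auto
    also have "\<dots> = 2 + log 2 (real \<tau>)"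
      using \<tau>_ge log_of_power_eq[of 4 2 2] by (simp add: log_mult)
    finally show ?thesis using lt by simp
  qed
  have P0: "0 < real P" "0 < real \<tau>" using P_ge \<tau>_ge by auto
  have "log 2 (real n) \<le> 4 * real b * (real \<tau> * real P)"
  proof -
    have "real n \<le> 2 ^ (b * (Suc P * (2 * \<tau>)))" using P_gt
      by (metis less_imp_le of_nat_le_iff of_nat_numeral of_nat_power)
    then have "log 2 (real n) \<le> log 2 (2 ^ (b * (Suc P * (2 * \<tau>))))" using n0 by (subst log_le_cancel_iff) auto
    also have "\<dots> = real (b * (Suc P * (2 * \<tau>)))" by simp
    also have "b * (Suc P * (2 * \<tau>)) \<le> b * ((2 * P) * (2 * \<tau>))"
      using P_ge by (intro mult_left_mono mult_right_mono) auto
    also have "real (b * ((2 * P) * (2 * \<tau>))) = 4 * real b * (real \<tau> * real P)" by simp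
    finally show ?thesis by simp
  qed
  also have "\<dots> \<le> 12 * log 2 (real \<tau>) * (real \<tau> * real P)"
    using b by (intro mult_right_mono) auto
  finally have "real n / (real \<tau> * real P) \<le> 12 * (real n * log 2 (real \<tau>) / log 2 (real n))"
    using P0 ln n0 by (simp add: field_simps)
  moreover have "real num_cells \<le> 2 + real n / (real \<tau> * real P)"
  proof -
    have "real num_cells \<le> 1 + real (Suc (n div \<tau>)) / real P"
      unfolding num_cells_def using of_nat_div_le_of_nat[of "Suc (n div \<tau>)" P] by simp
    also have "\<dots> \<le> 1 + (1 + real n / real \<tau>) / real P"
      using P0 of_nat_div_le_of_nat[of n \<tau>] by (intro add_left_mono divide_right_mono) auto
    also have "\<dots> \<le> 2 + real n / (real \<tau> * real P)"
      using P0 P_ge by (simp add: field_simps)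
    finally show ?thesis .
  qed
  moreover have "real (6 + full) \<le> 3 * (real n * log 2 (real \<tau>) / log 2 (real n))"
  proof -
    have "real full * real full \<le> real n" using full_sq by (metis of_nat_le_iff of_nat_mult)
    then have "real full \<le> sqrt (real n)" by (intro real_le_rsqrt) (simp add: power2_eq_square)
    moreover have "4 \<le> sqrt (real n)" using n0 by (intro real_le_rsqrt) simp
    ultimately have "real (6 + full) \<le> 3 * sqrt (real n)" by simp
    also have "sqrt (real n) = real n / sqrt (real n)" using n0 by (simp add: real_div_sqrt)
    also have "\<dots> \<le> real n / log 2 (real n)" using sqrt ln n0 by (intro divide_left_mono) auto
    also have "\<dots> \<le> real n / log 2 (real n) * log 2 (real \<tau>)"
      using mult_left_mono[OF lt, of "real n / log 2 (real n)"] ln n0 by simp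
    finally show ?thesis by simp
  qed
  moreover have "length D = 4 + full + num_cells" using D by (simp add: valid_structure_def)
  ultimately show ?thesis by simp
qed

lemma structure_correct:
  assumes \<sigma>: "\<sigma> \<le> n ^ k" and T: "set T \<subseteq> {0..<\<sigma>}" and sqrt: "log 2 (real n) \<le> sqrt (real n)"
    and C: "real ((122 + 30 * k) * n) \<le> t" "33 \<le> C"
  shows "\<exists>D. constructs bw (build_prog k) T \<sigma> \<tau> t D \<and>
    real (length D) \<le> 15 * (real n * log 2 (real \<tau>) / log 2 (real n)) \<and>
    answers_min_suffix_queries bw query_prog D T \<tau> C"
proof -
  have "n ^ k * 1 \<le> n ^ k * n ^ 5" using n_ge by (intro mult_left_mono) auto
  then have \<sigma>_less: "\<sigma> < 2 ^ bw" using \<sigma> pow_less_word[of k] by linarith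
  have fits: "fits bw (init [n, \<sigma>, \<tau>] T)"
    using bounds \<sigma>_less T by (intro fits_init) auto
  obtain t' R M where e: "exec bw (build_prog k) (init [n, \<sigma>, \<tau>] T) t' (R, M)"
    "t' \<le> (122 + 30 * k) * n" "valid_structure (map M [R 0..<R 0 + R 1])"
    using wp_build[of \<sigma>] unfolding wp_def by auto
  define D where "D = map M [R 0..<R 0 + R 1]"
  have "constructs bw (build_prog k) T \<sigma> \<tau> t D"
    unfolding constructs_def length_T using fits e(1,2) C(1) D_def
    by (intro conjI exI[of _ t'] exI[of _ R] exI[of _ M]) (auto simp: of_nat_le_iff[symmetric, where 'a = real] simp del: of_nat_le_iff)
  moreover have "answers_min_suffix_queries bw query_prog D T \<tau> C"
    unfolding answers_min_suffix_queries_def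
  proof (intro allI impI)
    fix l r assume lr: "l \<le> r \<and> r < length T \<and> length (fragment T l r) \<le> \<tau>"
    then have lr': "l \<le> r" "r < n" "Suc r - l \<le> \<tau>" by (auto simp: length_T fragment_eq_map simp del: upt_Suc)
    \<comment> \<open>Execution keeps all values below \<open>2 ^ bw\<close>, so the words of
      \<open>D\<close> are admissible memory contents for a query.\<close>
    have "fits bw (R, M)" using fits_exec[OF e(1) fits] .
    then have "fits bw (init [l, r] D)"
      using lr' bounds by (intro fits_init) (auto simp: D_def fits_def)
    moreover obtain t' R' M' where "exec bw query_prog (init [l, r] D) t' (R', M')" "t' \<le> 33"
      "R' 0 = length (min_suffix (fragment T l r))"
      using wp_query[OF lr'] e(3) unfolding D_def wp_def by fastforce
    ultimately show "fits bw (init [l, r] D) \<and> (\<exists>t R M. exec bw query_prog (init [l, r] D) t (R, M) \<and>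
        real t \<le> C \<and> R 0 = length (min_suffix (fragment T l r)))"
      using C(2) by fastforce
  qed
  ultimately show ?thesis using size_bound[OF e(3) sqrt] D_def by blast
qed

end

text \<open>The base \<open>4 * \<tau>\<close> is the bound for \<open>2 ^ b\<close>, so the claim
  makes a whole window fit into \<open>log 2 n\<close> bits. The constant \<open>1 / 4\<close> gives
  \<open>4 * t * LL \<le> L\<close>, and \<open>log 2 (4 * t) = 2 + log 2 t \<le> 2 * LL\<close>
  once \<open>LL \<ge> 2\<close>; multiplied by \<open>2 * t\<close> this stays within
  \<open>L\<close>.\<close>

lemma eventually_power_le:
  fixes \<tau> :: "nat \<Rightarrow> nat"
  assumes "\<forall>n. 1 \<le> \<tau> n" "(\<lambda>n. real (\<tau> n)) \<in> o(\<lambda>n. log 2 (real n) / log 2 (log 2 (real n)))"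
  shows "\<forall>\<^sub>F n in sequentially. (4 * \<tau> n) ^ (2 * \<tau> n) \<le> n"
proof -
  have "\<forall>\<^sub>F n in sequentially. norm (real (\<tau> n)) \<le> 1 / 4 * norm (log 2 (real n) / log 2 (log 2 (real n)))"
    by (rule landau_o.smallD[OF assms(2)]) simp
  moreover have "\<forall>\<^sub>F n in sequentially. 2 \<le> log 2 (log 2 (real n))" by real_asymp
  moreover have "\<forall>\<^sub>F n in sequentially. 1 \<le> log 2 (real n)" by real_asymp
  moreover have "\<forall>\<^sub>F n in sequentially. (1::nat) \<le> n" by (rule eventually_ge_at_top)
  ultimately show ?thesis
  proof eventually_elim
    case (elim n)
    define L where "L = log 2 (real n)"
    define LL where "LL = log 2 L"
    define t where "t = real (\<tau> n)"
    have LL: "2 \<le> LL" "1 \<le> L" using elim by (auto simp: L_def LL_def)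
    have t: "1 \<le> t" using assms(1) by (simp add: t_def)
    have tL: "t \<le> L / (4 * LL)" using elim(1) LL t by (simp add: L_def[symmetric] LL_def[symmetric] t_def)
    also have "\<dots> \<le> L" using LL by (simp add: field_simps)
    finally have "log 2 t \<le> LL" unfolding LL_def using t LL by (subst log_le_cancel_iff) auto
    moreover have "log 2 (4 * t) = 2 + log 2 t" using t log_of_power_eq[of 4 2 2] by (simp add: log_mult)
    ultimately have "log 2 (4 * t) \<le> 2 * LL" using LL by simp
    then have "2 * t * log 2 (4 * t) \<le> 2 * t * (2 * LL)" using t by (intro mult_left_mono) auto
    also have "\<dots> \<le> L" using tL LL by (simp add: field_simps)
    finally have "log 2 ((4 * t) ^ (2 * \<tau> n)) \<le> L" using t log_nat_power[of "4 * t" 2 "2 * \<tau> n"]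
      by (simp add: t_def del: power_mult_distrib)
    then have "(4 * t) ^ (2 * \<tau> n) \<le> real n"
      unfolding L_def using t elim(4) by (subst (asm) log_le_cancel_iff) auto
    then have "real ((4 * \<tau> n) ^ (2 * \<tau> n)) \<le> real n" by (simp add: t_def)
    then show ?case by (simp only: of_nat_le_iff)
  qed
qed

text \<open>Both parameters come from rounded logarithms: \<open>b\<close> from that of
  \<open>2 * \<tau>\<close> in base \<open>2\<close>, \<open>P\<close> from that of \<open>n\<close>
  in base \<open>F\<close>, where \<open>F\<close> counts the bit patterns of a window.
  \<open>F \<le> n\<close> ensures that a cell holds at least one window.\<close>

lemma min_suffix_params_exist:
  assumes "length T = n" "\<And>i. i < n \<Longrightarrow> T ! i < n ^ k" "n ^ (k + 6) \<le> 2 ^ bw" "16 \<le> n" "2 \<le> \<tau>"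
    "(4 * \<tau>) ^ (2 * \<tau>) \<le> n"
  shows "\<exists>b P. min_suffix_params bw k n \<tau> b P T"
proof -
  obtain b' where b': "(2::nat) ^ b' \<le> 2 * \<tau>" "2 * \<tau> < 2 ^ (b' + 1)"
    using ex_power_ivl1[of 2 "2 * \<tau>"] assms(5) by auto
  define b where "b = Suc b'"
  have b: "2 * \<tau> < 2 ^ b" "2 ^ b \<le> 4 * \<tau>" using b' by (simp_all add: b_def)
  define F where "F = (2::nat) ^ (b * (2 * \<tau>))"
  have "F \<le> n"
  proof -
    have "F = (2 ^ b) ^ (2 * \<tau>)" by (simp add: F_def power_mult)
    also have "\<dots> \<le> (4 * \<tau>) ^ (2 * \<tau>)" using b by (intro power_mono) auto
    finally show ?thesis using assms(6) by simp
  qed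
  have "2 ^ 1 \<le> F" unfolding F_def using assms(5) by (intro power_increasing) (auto simp: b_def)
  then obtain P where P: "F ^ P \<le> n" "n < F ^ (P + 1)" using ex_power_ivl1[of F n] assms(4) by auto
  have "P \<noteq> 0" using P \<open>F \<le> n\<close> by (intro notI) simp
  have F_pow: "F ^ i = 2 ^ (b * (i * (2 * \<tau>)))" for i
    unfolding F_def by (simp flip: power_mult add: mult_ac)
  have "2 ^ (b * (P * (2 * \<tau>))) \<le> n" "n < 2 ^ (b * (Suc P * (2 * \<tau>)))"
    using P unfolding F_pow by (simp_all del: mult_Suc)
  then have "min_suffix_params bw k n \<tau> b P T"
    by unfold_locales (use assms b \<open>P \<noteq> 0\<close> in auto)
  then show ?thesis by blast
qed

(* A machine word has W bits. Since W is only assumed to be at least c * log n for an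
   arbitrary constant c > 0, positions and characters need a constant number of words; the RAM
   therefore computes with cells of d words each, for a constant d depending on c and k only.
   The size of the data structure is nevertheless measured in words of W bits. *)

theorem theorem21:
  fixes c :: real and k :: nat
  assumes "c > 0"
  shows "\<exists>(d::nat) (build::prog) (query::prog) (C::real).
    \<forall>\<tau> :: nat \<Rightarrow> nat.
      (\<forall>n. 1 \<le> \<tau> n) \<longrightarrow>
      (\<lambda>n. real (\<tau> n)) \<in> o(\<lambda>n. log 2 (real n) / log 2 (log 2 (real n))) \<longrightarrow>
      (\<forall>\<^sub>F n in sequentially.
        \<forall>(W::nat) (\<sigma>::nat) (T::nat list).
          c * log 2 (real n) \<le> real W \<longrightarrow> \<sigma> \<le> n ^ k \<longrightarrow>
          length T = n \<longrightarrow> set T \<subseteq> {0..<\<sigma>} \<longrightarrow>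
          (\<exists>D. constructs (d * W) build T \<sigma> (\<tau> n) (C * real n) D \<and>
               real (d * length D) \<le> C * (real n * log 2 (real (\<tau> n)) / log 2 (real n)) \<and>
               answers_min_suffix_queries (d * W) query D T (\<tau> n) C))"
proof -
  \<comment> \<open>With this \<open>d\<close>, a cell of \<open>d * W\<close> bits has at least
    \<open>(k + 6) * log 2 n\<close> bits.\<close>
  define d where "d = nat \<lceil>real (k + 6) / c\<rceil>"
  \<comment> \<open>One constant for all bounds: \<open>122 + 30 * k\<close> covers construction and
    queries, \<open>15 * d\<close> the size, where the factor \<open>d\<close> converts cells into
    words of \<open>W\<close> bits.\<close>
  define C where "C = real (122 + 30 * k) + 15 * real d"
  have d: "real (k + 6) \<le> real d * c"
    using assms real_nat_ceiling_ge[of "real (k + 6) / c"]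
    unfolding d_def[symmetric] by (simp only: pos_divide_le_eq)
  have "\<exists>D. constructs (d * W) (build_prog k) T \<sigma> \<tau> (C * real n) D \<and>
      real (d * length D) \<le> C * (real n * log 2 (real \<tau>) / log 2 (real n)) \<and>
      answers_min_suffix_queries (d * W) query_prog D T \<tau> C"
    if n: "16 \<le> n" "log 2 (real n) \<le> sqrt (real n)" and \<tau>: "1 \<le> \<tau>" "(4 * \<tau>) ^ (2 * \<tau>) \<le> n"
      and W: "c * log 2 (real n) \<le> real W" and T: "\<sigma> \<le> n ^ k" "length T = n" "set T \<subseteq> {0..<\<sigma>}"
    for n \<tau> W \<sigma> :: nat and T
  proof -
    have ln: "0 \<le> log 2 (real n)" using n by simp
    have word: "n ^ (k + 6) \<le> 2 ^ (d * W)"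
    proof -
      have "real (k + 6) * log 2 (real n) \<le> real d * c * log 2 (real n)"
        using d ln by (rule mult_right_mono)
      also have "\<dots> \<le> real d * real W" using W by (simp add: mult.assoc mult_left_mono)
      finally have "log 2 (real n ^ (k + 6)) \<le> log 2 (2 ^ (d * W))"
        using n by (simp add: log_nat_power)
      then have "real n ^ (k + 6) \<le> 2 ^ (d * W)" using n by (subst (asm) log_le_cancel_iff) auto
      then have "real (n ^ (k + 6)) \<le> real (2 ^ (d * W))" by simp
      then show ?thesis by (simp only: of_nat_le_iff)
    qed
    show ?thesis
    proof (cases "\<tau> = 1")
      case False
      have "T ! i < n ^ k" if "i < n" for i
        using T that nth_mem[of i T] by fastforce
      with min_suffix_params_exist[of T n k "d * W" \<tau>] obtain b P
        where "min_suffix_params (d * W) k n \<tau> b P T"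
        using T word n \<tau> False by auto
      then interpret min_suffix_params "d * W" k n \<tau> b P T .
      obtain D where D: "constructs (d * W) (build_prog k) T \<sigma> \<tau> (C * real n) D"
        "real (length D) \<le> 15 * (real n * log 2 (real \<tau>) / log 2 (real n))"
        "answers_min_suffix_queries (d * W) query_prog D T \<tau> C"
        using structure_correct[OF T(1,3) n(2), of "C * real n" C]
        by (auto simp: C_def algebra_simps)
      define X where "X = real n * log 2 (real \<tau>) / log 2 (real n)"
      have "0 \<le> X" using ln \<tau> by (simp add: X_def)
      then have "0 \<le> real (122 + 30 * k) * X" by (intro mult_nonneg_nonneg) auto
      moreover have "real (d * length D) \<le> real d * (15 * X)"
        unfolding of_nat_mult X_def by (rule mult_left_mono[OF D(2)]) simp
      moreover have "C * X = real (122 + 30 * k) * X + real d * (15 * X)"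
        by (simp add: C_def algebra_simps)
      ultimately have "real (d * length D) \<le> C * X" by linarith
      then have "real (d * length D) \<le> C * (real n * log 2 (real \<tau>) / log 2 (real n))"
        unfolding X_def .
      with D show ?thesis by blast
    next
      case True
      have pow: "n ^ j < n ^ (k + 6)" if "j < k + 6" for j
        using n that by (intro power_strict_increasing) auto
      have small: "n < 2 ^ (d * W)" "n ^ k < 2 ^ (d * W)" using pow[of 1] pow[of k] word by auto
      then have one: "1 < (2::nat) ^ (d * W)" using n by linarith
      have fits: "fits (d * W) (init [n, \<sigma>, 1] T)"
        using small T n one by (intro fits_init) auto
      have C: "4 \<le> C * real n" "3 \<le> C"
      proof -
        show "3 \<le> C" by (simp add: C_def)
        then show "4 \<le> C * real n" using n mult_mono[of 3 C 16 "real n"] by simp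
      qed
      have "constructs (d * W) (build_prog k) T \<sigma> \<tau> (C * real n) []"
        unfolding constructs_def T(2) True
        using fits wp_build_one[OF one, of k n \<sigma> T] C(1) unfolding wp_def by fastforce
      moreover have "answers_min_suffix_queries (d * W) query_prog [] T \<tau> C"
        unfolding answers_min_suffix_queries_def
      proof (intro allI impI)
        fix l r assume lr: "l \<le> r \<and> r < length T \<and> length (fragment T l r) \<le> \<tau>"
        then have "r = l" using True by (auto simp: fragment_eq_map simp del: upt_Suc)
        moreover have "fits (d * W) (init [l, l] [])" using lr T(2) small by (intro fits_init) auto
        ultimately show "fits (d * W) (init [l, r] []) \<and> (\<exists>t R M. exec (d * W) query_prog (init [l, r] []) t (R, M) \<and>
            real t \<le> C \<and> R 0 = length (min_suffix (fragment T l r)))"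
          using wp_query_singleton[OF one, of l T "[]"] lr C(2) unfolding wp_def by fastforce
      qed
      ultimately show ?thesis using True by (intro exI[of _ "[]"]) simp
    qed
  qed
  note main = this
  have sqrt: "\<forall>\<^sub>F n in sequentially. log 2 (real n) \<le> sqrt (real n)" by real_asymp
  show ?thesis
  proof (rule exI[of _ d], rule exI[of _ "build_prog k"], rule exI[of _ query_prog], rule exI[of _ C],
      intro allI impI)
    fix \<tau> :: "nat \<Rightarrow> nat"
    assume \<tau>: "\<forall>n. 1 \<le> \<tau> n" "(\<lambda>n. real (\<tau> n)) \<in> o(\<lambda>n. log 2 (real n) / log 2 (log 2 (real n)))"
    show "\<forall>\<^sub>F n in sequentially. \<forall>(W::nat) (\<sigma>::nat) (T::nat list).
          c * log 2 (real n) \<le> real W \<longrightarrow> \<sigma> \<le> n ^ k \<longrightarrow>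
          length T = n \<longrightarrow> set T \<subseteq> {0..<\<sigma>} \<longrightarrow>
          (\<exists>D. constructs (d * W) (build_prog k) T \<sigma> (\<tau> n) (C * real n) D \<and>
               real (d * length D) \<le> C * (real n * log 2 (real (\<tau> n)) / log 2 (real n)) \<and>
               answers_min_suffix_queries (d * W) query_prog D T (\<tau> n) C)"
      using eventually_power_le[OF \<tau>] sqrt eventually_ge_at_top[of 16]
      by eventually_elim (use main \<tau>(1) in blast)
  qed
qed

end
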